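(* Let $H$ be a division ring of finite dimension over its center $Z(H)$, let $n$ be a positive integer, and let $L$ be a division ring with $H \subseteq L \subseteq H(T_1, \dots, T_n)$. (1) Assume $n=1$ and $L \neq H$. Then there exists $f \in Z(H)(T_1) \setminus Z(H)$ such that $L = H(f)$. (2) Assume there is $g \in Z(H)(T_1, \dots, T_n)$ such that the extension $L/H(g)$ is algebraic and such that $g$ is not algebraic over $H$. Then there exists $f \in Z(H)(T_1, \dots, T_n) \setminus Z(H)$ such that $L = H(f)$.
   Context: For a division ring $H$, $H[T_1,\dots,T_n]$ denotes the polynomial ring over $H$ in $n$ independent central (commuting with everything) variables; it is a right Ore domain, and $H(T_1,\dots,T_n)$ denotes its (unique up to isomorphism) division ring of right fractions, whose elements are $ab^{-1}$ with $a,b$ polynomials, $b\neq 0$. Its center is $Z(H)(T_1,\dots,T_n)$, the usual rational function field over the field $Z(H)$. For an extension of division rings $L/H$ and a subset $S \subseteq L$, $H(S)$ denotes the intersection of all division subrings of $L$ containing $H$ and $S$ (written $H(x)$ when $S=\{x\}$). The degree $[L:H]$ is the dimension of $L$ as a left $H$-vector space. An element $x \in L$ is algebraic over $H$ if $[H(x):H] < \infty$, and $L/H$ is algebraic if every element of $L$ is algebraic over $H$. *)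

theory Defs
  imports "HOL-Library.Poly_Mapping" "HOL-Library.Cardinality"
begin

text \<open>Since \<open>inverse 0 = 0\<close> in class \<open>division_ring\<close>, closure under \<open>inverse\<close> needs no
  exception at \<open>0\<close>.\<close>

definition division_subring :: "'a::division_ring set \<Rightarrow> bool" where
  "division_subring K \<longleftrightarrow>
     1 \<in> K \<and> (\<forall>x\<in>K. \<forall>y\<in>K. x - y \<in> K \<and> x * y \<in> K) \<and> (\<forall>x\<in>K. inverse x \<in> K)"

text \<open>The intersection is over the division subrings of the whole type; passing to a division
  subring of the type that contains \<open>K\<close> and \<open>S\<close> gives the same set.\<close>

definition adjoin :: "'a::division_ring set \<Rightarrow> 'a set \<Rightarrow> 'a set" where
  "adjoin K S = \<Inter>{M. division_subring M \<and> K \<union> S \<subseteq> M}"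

definition ring_center :: "'a::division_ring set" where
  "ring_center = {z. \<forall>x. z * x = x * z}"

text \<open>Scalars act by multiplication on the left and come from a subset \<open>K\<close>, possibly
  noncommutative, so the library's \<open>vector_space\<close> (scalars forming a field type) does not apply.\<close>

definition finite_left_basis :: "'a::division_ring set \<Rightarrow> 'a set \<Rightarrow> 'a set \<Rightarrow> bool" where
  "finite_left_basis K V B \<longleftrightarrow> finite B \<and> B \<subseteq> V \<and>
     (\<forall>c. (\<forall>b\<in>B. c b \<in> K) \<and> (\<Sum>b\<in>B. c b * b) = 0 \<longrightarrow> (\<forall>b\<in>B. c b = 0)) \<and>
     V = {v. \<exists>c. (\<forall>b\<in>B. c b \<in> K) \<and> v = (\<Sum>b\<in>B. c b * b)}"

definition finite_left_dim :: "'a::division_ring set \<Rightarrow> 'a set \<Rightarrow> bool" where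
  "finite_left_dim K V \<longleftrightarrow> (\<exists>B. finite_left_basis K V B)"

definition algebraic_over :: "'a::division_ring set \<Rightarrow> 'a \<Rightarrow> bool" where
  "algebraic_over K x \<longleftrightarrow> finite_left_dim K (adjoin K {x})"

definition algebraic_extension :: "'a::division_ring set \<Rightarrow> 'a set \<Rightarrow> bool" where
  "algebraic_extension K L \<longleftrightarrow> K \<subseteq> L \<and> (\<forall>x\<in>L. algebraic_over K x)"

text \<open>The monoid algebra of \<open>'n \<Rightarrow>\<^sub>0 nat\<close> over \<open>'h\<close>: its variables, indexed by \<open>'n\<close>, commute with
  each other and with the coefficients, even if \<open>'h\<close> is noncommutative.\<close>

type_synonym ('n, 'h) mpoly = "('n \<Rightarrow>\<^sub>0 nat) \<Rightarrow>\<^sub>0 'h"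

text \<open>The division ring of right fractions is determined only up to isomorphism, so it is given by
  an arbitrary division ring \<open>'d\<close> with an embedding \<open>\<iota>\<close> of the polynomial ring such
  that every element of \<open>'d\<close> is a right fraction.\<close>

definition right_fraction_ring ::
    "(('n, 'h::division_ring) mpoly \<Rightarrow> 'd::division_ring) \<Rightarrow> bool" where
  "right_fraction_ring \<iota> \<longleftrightarrow>
     \<iota> 1 = 1 \<and> (\<forall>p q. \<iota> (p + q) = \<iota> p + \<iota> q) \<and> (\<forall>p q. \<iota> (p * q) = \<iota> p * \<iota> q) \<and> inj \<iota> \<and>
     (\<forall>d. \<exists>a b. b \<noteq> 0 \<and> d = \<iota> a * inverse (\<iota> b))"

definition const_image ::
    "(('n, 'h::division_ring) mpoly \<Rightarrow> 'd::division_ring) \<Rightarrow> 'h set \<Rightarrow> 'd set" where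
  "const_image \<iota> A = (\<lambda>h. \<iota> (Poly_Mapping.single 0 h)) ` A"

text \<open>For \<open>A\<close> the centre of \<open>'h\<close>, this is the rational function field over that centre.\<close>

definition rational_functions ::
    "(('n, 'h::division_ring) mpoly \<Rightarrow> 'd::division_ring) \<Rightarrow> 'h set \<Rightarrow> 'd set" where
  "rational_functions \<iota> A =
     {\<iota> a * inverse (\<iota> b) | a b.
        range (Poly_Mapping.lookup a) \<subseteq> A \<and> range (Poly_Mapping.lookup b) \<subseteq> A \<and> b \<noteq> 0}"

end

theory Submission
  imports Defs "HOL-Computational_Algebra.Polynomial_Factorial"
    "HOL-Computational_Algebra.Field_as_Ring"
begin

text \<open>
  Let \<open>k\<close> be the centre of \<open>H\<close> and \<open>F = k(T\<^sub>1, \<dots>, T\<^sub>n)\<close>. Since \<open>H\<close> is finite-dimensional over \<open>k\<close>, every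
  fraction is a sum \<open>h\<^sub>1 c\<^sub>1 + \<dots> + h\<^sub>m c\<^sub>m\<close> with \<open>h\<^sub>i \<in> H\<close> and \<open>c\<^sub>i \<in> F\<close>, and commutators with \<open>H\<close> shorten such
  sums; so \<open>F\<close> is the centralizer of \<open>H\<close> and \<open>L\<close> is generated by \<open>H\<close> and the field \<open>E = L \<inter> F\<close>. It
  remains to show \<open>E = k(f)\<close>.

  For \<open>n = 1\<close> this is Lueroth's theorem. In the second case commutators turn a relation of least degree
  for \<open>e \<in> E\<close> over \<open>H(g)\<close> into one over \<open>k(g)\<close>, so \<open>E\<close> is algebraic over \<open>k(g)\<close>. Embed \<open>F\<close> into the
  fraction field of \<open>k[t][s\<^sub>1, \<dots>, s\<^sub>n]\<close> by \<open>T\<^sub>i \<mapsto> t\<^bsup>w\<^sub>i\<^esup> + s\<^sub>i\<close>, with weights as in Kronecker's substitution.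
  Taking lowest terms in the \<open>s\<^sub>i\<close> is a place with values in \<open>k(t)\<close> that sends \<open>g\<close> to a nonconstant
  element. It is defined and injective on \<open>k(g)\<close>, hence on the algebraic extension \<open>E\<close>, which thus embeds
  into \<open>k(t)\<close>, and Lueroth's theorem applies. This works over every field \<open>k\<close>, finite or not.
\<close>

section \<open>Division subrings\<close>

text \<open>The substitution of powers of \<open>t\<close> alone has a kernel when there are several
  variables, and the denominators of the elements of \<open>E\<close> are not under control, so it
  gives no map on \<open>E\<close>. Weights can only be fitted to one chosen fraction for
  \<open>g\<close>. The variables \<open>s\<close> repair this: they keep the substitution
  injective, since at \<open>t = 0\<close> it merely renames variables, and the return to
  \<open>k(t)\<close> is then left to a place, which is partial but tame. It is defined on elements
  integral over its domain because a valuation ring is integrally closed, and it is injective on any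
  field inside its domain because a nonzero element sent to \<open>0\<close> would have an inverse
  with an image. Powers of \<open>t\<close> are used instead of values in \<open>k\<close> because a
  finite \<open>k\<close> may have too few values to keep \<open>g\<close> nonconstant.

  A place needs commutative relations, while being algebraic over \<open>H(g)\<close> is a one-sided
  linear condition over a noncommutative ring; hence the descent to \<open>k(g)\<close> comes before
  any place is applied.\<close>

lemma division_subring_0: "division_subring K \<Longrightarrow> 0 \<in> K"
  unfolding division_subring_def by (metis diff_self)

lemma division_subring_1: "division_subring K \<Longrightarrow> 1 \<in> K"
  unfolding division_subring_def by blast

lemma division_subring_diff: "division_subring K \<Longrightarrow> x \<in> K \<Longrightarrow> y \<in> K \<Longrightarrow> x - y \<in> K"
  unfolding division_subring_def by blast

lemma division_subring_mult: "division_subring K \<Longrightarrow> x \<in> K \<Longrightarrow> y \<in> K \<Longrightarrow> x * y \<in> K"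
  unfolding division_subring_def by blast

lemma division_subring_inverse: "division_subring K \<Longrightarrow> x \<in> K \<Longrightarrow> inverse x \<in> K"
  unfolding division_subring_def by blast

lemma division_subring_uminus: "division_subring K \<Longrightarrow> x \<in> K \<Longrightarrow> - x \<in> K"
  using division_subring_diff[OF _ division_subring_0] by fastforce

lemma division_subring_add: "division_subring K \<Longrightarrow> x \<in> K \<Longrightarrow> y \<in> K \<Longrightarrow> x + y \<in> K"
  using division_subring_diff[of K x "- y"] division_subring_uminus[of K y] by simp

lemma division_subring_divide: "division_subring K \<Longrightarrow> x \<in> K \<Longrightarrow> y \<in> K \<Longrightarrow> x / y \<in> K"
  by (simp add: divide_inverse division_subring_mult division_subring_inverse)

lemma division_subring_power: "division_subring K \<Longrightarrow> x \<in> K \<Longrightarrow> x ^ n \<in> K"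
  by (induction n) (auto intro: division_subring_1 division_subring_mult)

lemma division_subring_sum:
  "division_subring K \<Longrightarrow> (\<And>i. i \<in> I \<Longrightarrow> f i \<in> K) \<Longrightarrow> sum f I \<in> K"
  by (induction I rule: infinite_finite_induct)
    (auto intro: division_subring_0 division_subring_add)

lemmas division_subring_closed =
  division_subring_0 division_subring_1 division_subring_diff division_subring_mult
  division_subring_inverse division_subring_uminus division_subring_add
  division_subring_divide division_subring_power division_subring_sum

lemma division_subringI:
  assumes "1 \<in> K" "\<And>x y. x \<in> K \<Longrightarrow> y \<in> K \<Longrightarrow> x - y \<in> K" "\<And>x y. x \<in> K \<Longrightarrow> y \<in> K \<Longrightarrow> x * y \<in> K"
    "\<And>x. x \<in> K \<Longrightarrow> x \<noteq> 0 \<Longrightarrow> inverse x \<in> K"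
  shows "division_subring K"
  unfolding division_subring_def using assms by (metis inverse_zero)

lemma division_subring_Int:
  "division_subring K \<Longrightarrow> division_subring M \<Longrightarrow> division_subring (K \<inter> M)"
  by (simp add: division_subring_def)

lemma division_subring_adjoin: "division_subring (adjoin K S)"
  by (auto simp: division_subring_def adjoin_def)

lemma adjoin_least: "division_subring M \<Longrightarrow> K \<subseteq> M \<Longrightarrow> S \<subseteq> M \<Longrightarrow> adjoin K S \<subseteq> M"
  by (auto simp: adjoin_def)

lemma adjoin_base: "K \<subseteq> adjoin K S"
  by (auto simp: adjoin_def)

lemma adjoin_gen: "S \<subseteq> adjoin K S"
  by (auto simp: adjoin_def)

lemma inverse_commute:
  fixes h x :: "'a::division_ring"
  assumes "h * x = x * h"
  shows "h * inverse x = inverse x * h"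
proof (cases "x = 0")
  case False
  have "h * inverse x = inverse x * (x * h) * inverse x"
    using False by (simp flip: mult.assoc)
  also have "\<dots> = inverse x * (h * x) * inverse x"
    using assms by simp
  also have "\<dots> = inverse x * h"
    using False by (simp add: mult.assoc)
  finally show ?thesis .
qed simp

lemma division_subring_centralizer: "division_subring {z. \<forall>h\<in>A. h * z = z * h}"
proof (rule division_subringI, goal_cases)
  case (3 x y)
  have "h * (x * y) = x * y * h" if "h \<in> A" for h
  proof -
    have "h * x = x * h" "h * y = y * h" using 3 that by auto
    then show ?thesis by (metis mult.assoc)
  qed
  then show ?case by simp
qed (auto simp: algebra_simps inverse_commute)

section \<open>Lueroth's theorem in one variable\<close>

definition coeffs_in :: "'a::zero set \<Rightarrow> 'a poly \<Rightarrow> bool" where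
  "coeffs_in S p \<longleftrightarrow> (\<forall>i. coeff p i \<in> S)"

text \<open>Long division divides only by the leading coefficient of \<open>q\<close>, so nothing
  leaves the subfield \<open>S\<close>. This gives minimal polynomials over a subfield that is a set
  and not a type.\<close>

lemma coeffs_in_division:
  fixes q :: "'a::field poly"
  assumes S: "division_subring S" and q: "coeffs_in S q" "q \<noteq> 0" and p: "coeffs_in S p"
  shows "\<exists>a r. coeffs_in S a \<and> coeffs_in S r \<and> p = a * q + r \<and> (r = 0 \<or> degree r < degree q)"
  using p
proof (induction "degree p" arbitrary: p rule: less_induct)
  case less
  note cl = division_subring_closed[OF S]
  show ?case
  proof (cases "p = 0 \<or> degree p < degree q")
    case True
    then show ?thesis using less.prems
      by (intro exI[of _ 0] exI[of _ p]) (auto simp: coeffs_in_def cl)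
  next
    case False
    define c where "c = lead_coeff p / lead_coeff q"
    define n where "n = degree p - degree q"
    define p' where "p' = p - monom c n * q"
    have c: "c \<in> S" using less.prems q by (auto simp: c_def coeffs_in_def cl)
    have cp': "coeffs_in S p'"
      using less.prems q c by (auto simp: p'_def coeffs_in_def coeff_monom_mult cl)
    have c0: "c \<noteq> 0" using False q by (simp add: c_def)
    have dm: "degree (monom c n * q) = degree p"
      using c0 q False by (simp add: degree_mult_eq degree_monom_eq n_def)
    have lc: "lead_coeff (monom c n * q) = lead_coeff p"
      using q degree_monom_eq[OF c0, of n] by (simp add: lead_coeff_mult) (simp add: c_def)
    have "coeff p' (degree p) = 0"
      using dm lc by (simp add: p'_def)
    moreover have "degree p' \<le> degree p"
      using dm by (auto simp: p'_def intro: degree_diff_le)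
    ultimately have "p' = 0 \<or> degree p' < degree p"
      by (metis le_neq_implies_less leading_coeff_0_iff)
    then show ?thesis
    proof
      assume "p' = 0"
      then show ?thesis using c
        by (intro exI[of _ "monom c n"] exI[of _ 0]) (auto simp: p'_def coeffs_in_def cl)
    next
      assume "degree p' < degree p"
      from less.hyps[OF this cp'] obtain a r where
        ar: "coeffs_in S a" "coeffs_in S r" "p' = a * q + r" "r = 0 \<or> degree r < degree q" by blast
      have "p = (a + monom c n) * q + r" using ar(3) by (simp add: p'_def algebra_simps)
      moreover have "coeffs_in S (a + monom c n)" using ar(1) c by (auto simp: coeffs_in_def cl)
      ultimately show ?thesis using ar by blast
    qed
  qed
qed

text \<open>The degree in the inner variable is additive. In each factor, among the coefficients of
  maximal inner degree, the one of largest outer index is taken; the product of their top terms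
  cannot cancel.\<close>

lemma degree_coeff_mult_bound:
  fixes P C :: "'a::idom poly poly"
  assumes P: "\<exists>i. N \<le> degree (coeff P i)" and PC: "\<And>i. degree (coeff (P * C) i) \<le> N"
    and "P \<noteq> 0"
  shows "degree (coeff C j) = 0"
proof (cases "C = 0")
  case False
  have aux: "\<exists>i. coeff R i \<noteq> 0 \<and> (\<forall>l. degree (coeff R l) \<le> degree (coeff R i)) \<and>
     (\<forall>l>i. coeff R l \<noteq> 0 \<longrightarrow> degree (coeff R l) < degree (coeff R i))"
    if R: "R \<noteq> 0" for R :: "'a poly poly"
  proof -
    define A where "A = {i. coeff R i \<noteq> 0}"
    have fin: "finite A" unfolding A_def
      by (rule finite_subset[of _ "{..degree R}"]) (auto simp: le_degree)
    have ne: "A \<noteq> {}" using R by (auto simp: A_def poly_eq_iff)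
    define d where "d = Max ((\<lambda>i. degree (coeff R i)) ` A)"
    define B where "B = {i\<in>A. degree (coeff R i) = d}"
    have dmax: "degree (coeff R l) \<le> d" if "l \<in> A" for l
      using that fin by (auto simp: d_def)
    have "d \<in> (\<lambda>i. degree (coeff R i)) ` A" unfolding d_def
      using fin ne by (intro Max_in) auto
    then have B: "finite B" "B \<noteq> {}" using fin by (auto simp: B_def)
    have "Max B \<in> B" using B by (intro Max_in)
    moreover have "l \<notin> B" if "l > Max B" for l using that B by (auto dest: Max_ge)
    ultimately have "coeff R (Max B) \<noteq> 0" "degree (coeff R (Max B)) = d"
      "\<And>l. l > Max B \<Longrightarrow> coeff R l \<noteq> 0 \<Longrightarrow> degree (coeff R l) \<noteq> d"
      by (auto simp: B_def A_def)
    moreover have "degree (coeff R l) \<le> d" for l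
      using dmax[of l] by (cases "coeff R l = 0") (auto simp: A_def)
    ultimately show ?thesis
      by (intro exI[of _ "Max B"]) (auto simp: le_neq_implies_less)
  qed
  obtain i0 where i0: "coeff P i0 \<noteq> 0" "\<And>l. degree (coeff P l) \<le> degree (coeff P i0)"
     "\<And>l. l > i0 \<Longrightarrow> coeff P l \<noteq> 0 \<Longrightarrow> degree (coeff P l) < degree (coeff P i0)"
    using aux[OF \<open>P \<noteq> 0\<close>] by blast
  obtain j0 where j0: "coeff C j0 \<noteq> 0" "\<And>l. degree (coeff C l) \<le> degree (coeff C j0)"
     "\<And>l. l > j0 \<Longrightarrow> coeff C l \<noteq> 0 \<Longrightarrow> degree (coeff C l) < degree (coeff C j0)"
    using aux[OF False] by blast
  define d where "d = degree (coeff P i0) + degree (coeff C j0)"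
  \<comment> \<open>Any other pair of indices exceeds \<open>i0\<close> in \<open>P\<close> or
    \<open>j0\<close> in \<open>C\<close>, where the inner degree is strictly below the
    maximum.\<close>
  have z: "coeff (coeff P i * coeff C (i0 + j0 - i)) d = 0" if "i \<le> i0 + j0" "i \<noteq> i0" for i
  proof (cases "coeff P i = 0 \<or> coeff C (i0 + j0 - i) = 0")
    case True then show ?thesis by auto
  next
    case nz: False
    have "degree (coeff P i * coeff C (i0 + j0 - i)) < d"
    proof (cases "i > i0")
      case True
      then show ?thesis using nz i0(3)[of i] j0(2)[of "i0 + j0 - i"]
        by (simp add: degree_mult_eq d_def)
    next
      case F: False
      then have "i0 + j0 - i > j0" using that by simp
      then show ?thesis using nz i0(2)[of i] j0(3)[of "i0 + j0 - i"]
        by (simp add: degree_mult_eq d_def)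
    qed
    then show ?thesis by (rule coeff_eq_0)
  qed
  have "coeff (coeff (P * C) (i0 + j0)) d
      = (\<Sum>i\<le>i0 + j0. coeff (coeff P i * coeff C (i0 + j0 - i)) d)"
    by (simp add: coeff_mult coeff_sum)
  also have "\<dots> = (\<Sum>i\<in>{i0}. coeff (coeff P i * coeff C (i0 + j0 - i)) d)"
    by (rule sum.mono_neutral_right) (auto simp: z)
  also have "\<dots> = lead_coeff (coeff P i0) * lead_coeff (coeff C j0)"
    by (simp add: d_def coeff_mult_degree_sum)
  also have "\<dots> \<noteq> 0" using i0 j0 by simp
  finally have "d \<le> N" using PC le_degree le_trans by blast
  moreover have "N \<le> degree (coeff P i0)" using P i0(2) le_trans by blast
  ultimately show ?thesis using j0(2)[of j] by (simp add: d_def)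
qed auto

abbreviation fract_consts :: "'k::field poly fract set" where
  "fract_consts \<equiv> range (\<lambda>c. to_fract [:c:])"

lemma Fract_in_fract_consts:
  assumes "v \<noteq> 0" "smult a u = smult b v" "a \<noteq> 0"
  shows "to_fract u / to_fract v \<in> fract_consts"
proof -
  have "u = smult (b / a) v"
    using assms by (metis divide_inverse_commute smult_smult smult_eq_iff)
  then have "to_fract u = to_fract [:b / a:] * to_fract v"
    by (metis to_fract_mult mult_pCons_left mult_zero_left add.right_neutral pCons_0_0)
  then show ?thesis using \<open>v \<noteq> 0\<close> by simp
qed

lemma poly_map_const_X:
  "poly (map_poly (\<lambda>c. to_fract [:c:]) p) (to_fract [:0, 1:]) = to_fract (p :: 'k::field poly)"
proof (induction p)
  case (pCons a p)
  have "pCons a p = [:a:] + [:0, 1:] * p" by simp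
  then have "to_fract (pCons a p) = to_fract [:a:] + to_fract [:0, 1:] * to_fract p"
    by (metis to_fract_add to_fract_mult)
  then show ?case using pCons by (simp add: map_poly_pCons)
qed simp

text \<open>The minimal polynomial of \<open>t\<close> over \<open>E\<close> is compared with
  \<open>v(t) u(Y) - u(t) v(Y)\<close>, where \<open>f = u / v\<close> is a nonconstant ratio of its
  coefficients. Degrees in \<open>t\<close> force both to have the same degree in \<open>Y\<close>,
  so \<open>t\<close> has no larger degree over \<open>k(f)\<close> than over \<open>E\<close>. The
  class \<open>field_gcd\<close> provides contents and Gauss's lemma over
  \<open>k[t]\<close>.\<close>

theorem Lueroth:
  fixes E :: "'k::field_gcd poly fract set"
  assumes E: "division_subring E" "fract_consts \<subseteq> E" and nonconst: "\<not> E \<subseteq> fract_consts"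
  shows "\<exists>f \<in> E - fract_consts. E \<subseteq> adjoin fract_consts {f}"
proof -
  note cl = division_subring_closed[OF E(1)]
  define t :: "'k poly fract" where "t = to_fract [:0, 1:]"
  define cst :: "'k poly \<Rightarrow> 'k poly poly" where "cst = map_poly (\<lambda>c. [:c:])"
  have coeff_cst [simp]: "coeff (cst p) i = [:coeff p i:]" for p i
    by (simp add: cst_def coeff_map_poly)
  have cst_t: "poly (fract_poly (cst p)) t = to_fract p" for p
    using poly_map_const_X[of p] by (simp add: cst_def t_def map_poly_map_poly o_def)
  \<comment> \<open>With \<open>Y\<close> for the outer variable this is
    \<open>v(t) u(Y) - u(t) v(Y)\<close>. It vanishes at \<open>Y = t\<close>, and divided by
    \<open>v(t)\<close> it has coefficients in \<open>k(u/v)\<close>.\<close>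
  define G where "G u v = smult v (cst u) - smult u (cst v)" for u v
  have coeff_G: "coeff (G u v) i = smult (coeff u i) v - smult (coeff v i) u" for u v i
    by (simp add: G_def mult.commute)
  have G_t: "poly (fract_poly (G u v)) t = 0" for u v
    by (simp add: G_def cst_t)
  have coeff_G': "coeff (smult (inverse (to_fract v)) (fract_poly (G u v))) i
     = to_fract [:coeff u i:] - to_fract u / to_fract v * to_fract [:coeff v i:]"
    if "v \<noteq> 0" for u v i
  proof -
    have "coeff (G u v) i = v * [:coeff u i:] - u * [:coeff v i:]"
      by (simp add: coeff_G mult.commute)
    then have "coeff (fract_poly (G u v)) i 
       = to_fract v * to_fract [:coeff u i:] - to_fract u * to_fract [:coeff v i:]"
      by (simp add: coeff_map_poly del: mult_pCons_right)
    then show ?thesis using that by (simp add: field_simps)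
  qed
  have G_nz: "coeff u i \<noteq> 0 \<or> coeff v i \<noteq> 0 \<Longrightarrow> coeff (G u v) i \<noteq> 0"
    if uv: "v \<noteq> 0" "to_fract u / to_fract v \<notin> fract_consts" for u v i
    using Fract_in_fract_consts[OF uv(1), of "coeff v i" u "coeff u i"] uv(1,2)
    by (cases "coeff v i = 0") (auto simp: coeff_G)
  define A where "A = {p. p \<noteq> 0 \<and> coeffs_in E p \<and> poly p t = 0}"
  have in_A: "smult (inverse (to_fract v)) (fract_poly (G u v)) \<in> A"
    if uv: "v \<noteq> 0" "to_fract u / to_fract v \<in> E - fract_consts" for u v
  proof -
    have "lead_coeff v \<noteq> 0" using uv by simp
    then have "G u v \<noteq> 0" using G_nz[of v u "degree v"] uv by fastforce
    moreover have "coeffs_in E (smult (inverse (to_fract v)) (fract_poly (G u v)))"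
      unfolding coeffs_in_def coeff_G'[OF uv(1)] using uv E(2) by (blast intro: cl)
    ultimately show ?thesis using uv by (simp add: A_def G_t)
  qed
  have quot: "\<exists>u v. v \<noteq> 0 \<and> coprime u v \<and> f = to_fract u / to_fract v" for f :: "'k poly fract"
    using coprime_quot_of_fract[of f]
    by (intro exI[of _ "fst (quot_of_fract f)"] exI[of _ "snd (quot_of_fract f)"])
      (simp flip: Fract_conv_to_fract)
  obtain f1 where "f1 \<in> E - fract_consts" using nonconst by blast
  with in_A quot[of f1] have "\<exists>p. p \<in> A" by blast
  then obtain M where M: "M \<in> A" and Mmin: "\<And>p. p \<in> A \<Longrightarrow> degree M \<le> degree p"
    using ex_has_least_nat[of "\<lambda>p. p \<in> A" _ degree] by blast
  have Mdvd: "M dvd p" if p: "coeffs_in E p" "poly p t = 0" for p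
  proof -
    obtain a r where ar: "coeffs_in E r" "p = a * M + r" "r = 0 \<or> degree r < degree M"
      using coeffs_in_division[OF E(1), of M p] M p by (auto simp: A_def)
    have "poly r t = 0" using ar p M by (simp add: A_def)
    then have "r = 0" using ar(1,3) Mmin[of r] by (cases "r = 0") (auto simp: A_def)
    then show ?thesis using ar by simp
  qed
  \<comment> \<open>For the primitive \<open>P\<close> over \<open>k[t]\<close> degrees in
    \<open>t\<close> make sense, and Gauss's lemma turns divisibility over \<open>k(t)\<close> into
    divisibility over \<open>k[t]\<close>.\<close>
  obtain c P where cP: "M = smult c (fract_poly P)" "content P = 1"
    using content_decompose_fract[of M] by blast
  have "M \<noteq> 0" using M by (simp add: A_def)
  then have c0: "c \<noteq> 0" and P0: "P \<noteq> 0" using cP by auto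
  define m where "m = degree P"
  have degM: "degree M = m" using cP c0 by (simp add: m_def degree_map_poly)
  define pm where "pm = lead_coeff P"
  have pm0: "pm \<noteq> 0" using P0 by (simp add: pm_def)
  have ratio: "to_fract (coeff P i) / to_fract pm \<in> E" for i
  proof -
    have "to_fract (coeff P i) / to_fract pm = coeff M i / coeff M m"
      using cP c0 by (simp add: coeff_map_poly pm_def m_def)
    then show ?thesis using M by (simp add: A_def coeffs_in_def cl)
  qed
  \<comment> \<open>If all ratios were constant, \<open>P\<close> would be a multiple of a
    polynomial over \<open>k\<close>, and \<open>t\<close> would be algebraic over
    \<open>k\<close>.\<close>
  have "\<exists>i. to_fract (coeff P i) / to_fract pm \<notin> fract_consts"
  proof (rule ccontr)
    assume "\<not> ?thesis"
    then have "\<forall>i. \<exists>c. to_fract (coeff P i) = to_fract [:c:] * to_fract pm"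
      using pm0 by (fastforce simp: field_simps)
    then have "\<forall>i. \<exists>c. coeff P i = [:c:] * pm" unfolding to_fract_mult[symmetric] to_fract_eq_iff .
    then obtain h where h: "\<And>i. coeff P i = [:h i:] * pm" by metis
    define q where "q = (\<Sum>i\<le>m. monom (h i) i)"
    have "coeff q i = h i" for i
    proof (cases "i \<le> m")
      case False
      then have "coeff P i = 0" by (simp add: m_def coeff_eq_0)
      then have "h i = 0" using h[of i] pm0 by simp
      then show ?thesis using False by (simp add: q_def coeff_sum)
    qed (simp add: q_def coeff_sum)
    then have "P = smult pm (cst q)" using h by (intro poly_eqI) (simp add: mult.commute)
    then have "poly (fract_poly P) t = to_fract pm * to_fract q" by (simp add: cst_t)
    moreover have "poly (fract_poly P) t = 0" using M cP c0 by (simp add: A_def)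
    ultimately have "q = 0" using pm0 by simp
    then show False using \<open>P = smult pm (cst q)\<close> P0 by (simp add: cst_def)
  qed
  then obtain i0 where i0: "to_fract (coeff P i0) / to_fract pm \<notin> fract_consts" by blast
  define f where "f = to_fract (coeff P i0) / to_fract pm"
  have fE: "f \<in> E - fract_consts" using i0 ratio by (simp add: f_def)
  obtain u v where uv: "v \<noteq> 0" "coprime u v" "f = to_fract u / to_fract v" using quot[of f] by blast
  have "(0 :: 'k poly fract) = to_fract [:0:]" by simp
  then have "(0 :: 'k poly fract) \<in> fract_consts" by blast
  then have "f \<noteq> 0" using fE by auto
  then have "u \<noteq> 0" "coeff P i0 \<noteq> 0" using uv by (auto simp: f_def)
  define N where "N = max (degree u) (degree v)"
  have "to_fract (coeff P i0 * v) = to_fract (u * pm)"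
    using uv pm0 f_def by (simp add: field_simps)
  then have cross: "coeff P i0 * v = u * pm" by (simp only: to_fract_eq_iff)
  \<comment> \<open>In lowest terms, \<open>u\<close> and \<open>v\<close> each divide a coefficient
    of \<open>P\<close>. So the degree of \<open>P\<close> in \<open>t\<close> is at least
    \<open>N\<close>, while that of \<open>G u v\<close> is at most \<open>N\<close>.\<close>
  have "v dvd pm" using cross uv(2) by (metis coprime_commute coprime_dvd_mult_right_iff dvd_triv_right)
  moreover have "u dvd coeff P i0" using cross uv(2) by (metis coprime_dvd_mult_left_iff dvd_triv_left)
  ultimately have "degree v \<le> degree (coeff P m)" "degree u \<le> degree (coeff P i0)"
    using pm0 \<open>coeff P i0 \<noteq> 0\<close> by (auto simp: pm_def m_def intro: dvd_imp_degree_le)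
  then have N: "\<exists>i. N \<le> degree (coeff P i)"
    unfolding N_def by (metis max_def)
  have fuv: "to_fract u / to_fract v \<in> E - fract_consts" using fE uv by simp
  define R where "R = smult (inverse (to_fract v)) (fract_poly (G u v))"
  have RA: "R \<in> A" unfolding R_def using in_A[OF uv(1) fuv] .
  have "M dvd R" using RA by (intro Mdvd) (auto simp: A_def)
  then have "fract_poly P dvd fract_poly (G u v)"
    using c0 uv(1) unfolding R_def cP(1) by (simp add: dvd_smult_cancel smult_dvd_iff dvd_smult_iff)
  then have "P dvd G u v" using cP(2) by (rule fract_poly_dvdD)
  then obtain C where C: "G u v = P * C" by (elim dvdE)
  have "degree (coeff C j) = 0" for j
  proof (rule degree_coeff_mult_bound[OF N _ P0])
    show "degree (coeff (P * C) i) \<le> N" for i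
      unfolding C[symmetric] coeff_G N_def
      by (intro degree_diff_le) (auto intro: le_trans[OF degree_smult_le])
  qed
  then have Cc: "coeff C j = [:coeff (coeff C j) 0:]" for j
    by (metis degree_eq_zeroE coeff_pCons_0)
  define C' where "C' = map_poly (\<lambda>a. coeff a 0) C"
  have C': "coeff C j = [:coeff C' j:]" for j
    using Cc[of j] by (simp add: C'_def coeff_map_poly)
  \<comment> \<open>The cofactor is free of \<open>t\<close>, so the coefficients of
    \<open>t ^ l\<close> in \<open>G u v = P * C\<close> can be compared.\<close>
  have C'dvd: "C' dvd smult (coeff v l) u - smult (coeff u l) v" for l
  proof
    define Pl where "Pl = map_poly (\<lambda>a. coeff a l) P"
    have "coeff (smult (coeff v l) u - smult (coeff u l) v) i = coeff (C' * Pl) i" for i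
    proof -
      have "coeff (coeff (G u v) i) l = (\<Sum>k\<le>i. coeff (coeff P k) l * coeff C' (i - k))"
        unfolding C coeff_mult[of P C] coeff_sum by (rule sum.cong) (simp_all add: C')
      also have "\<dots> = coeff (Pl * C') i"
        by (simp add: coeff_mult Pl_def coeff_map_poly)
      finally show ?thesis by (simp add: coeff_G mult.commute[of C'] mult.commute[of "coeff _ l"])
    qed
    then show "smult (coeff v l) u - smult (coeff u l) v = C' * Pl" by (rule poly_eqI)
  qed
  have "\<exists>l. coeff v k * coeff u l \<noteq> coeff u k * coeff v l" if "coeff v k \<noteq> 0" for k
  proof (rule ccontr)
    assume "\<not> ?thesis"
    then have "smult (coeff v k) u = smult (coeff u k) v" by (intro poly_eqI) simp
    from Fract_in_fract_consts[OF uv(1) this that] fuv show False by simp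
  qed
  moreover have "\<exists>k. coeff v k \<noteq> 0" using uv(1) by (metis leading_coeff_0_iff)
  \<comment> \<open>The coefficient vectors of \<open>u\<close> and \<open>v\<close> are linearly
    independent, so some 2 by 2 minor is nonzero; Cramer's rule then shows that \<open>C'\<close>
    divides both \<open>u\<close> and \<open>v\<close>.\<close>
  ultimately obtain k l where kl: "coeff v k * coeff u l - coeff u k * coeff v l \<noteq> 0"
    by (metis right_minus_eq)
  define D where "D = coeff v k * coeff u l - coeff u k * coeff v l"
  have "smult D u = smult (coeff u l) (smult (coeff v k) u - smult (coeff u k) v)
      - smult (coeff u k) (smult (coeff v l) u - smult (coeff u l) v)"
    by (intro poly_eqI) (simp add: D_def algebra_simps)
  then have "C' dvd smult D u" using C'dvd by (metis dvd_diff dvd_smult)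
  moreover have "smult D v = smult (coeff v l) (smult (coeff v k) u - smult (coeff u k) v)
      - smult (coeff v k) (smult (coeff v l) u - smult (coeff u l) v)"
    by (intro poly_eqI) (simp add: D_def algebra_simps)
  then have "C' dvd smult D v" using C'dvd by (metis dvd_diff dvd_smult)
  ultimately have "C' dvd u" "C' dvd v" using kl by (auto simp: D_def dvd_smult_iff)
  then have "is_unit C'" using uv(2) by (rule_tac coprime_common_divisor)
  then have "degree C' = 0" by (metis is_unit_iff_degree not_is_unit_0)
  then have degC: "degree C = 0"
    using C' by (metis coeff_eq_0 degree_0 eq_zero_or_degree_less le_degree leading_coeff_0_iff
       neq0_conv pCons_0_0)
  have dR: "degree R = degree (G u v)" using uv by (simp add: R_def degree_map_poly)
  have "G u v \<noteq> 0" using RA by (auto simp: A_def R_def)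
  then have "degree (G u v) = degree P" using C degC P0
    by (simp add: degree_mult_eq)
  then have dRm: "degree R = m" by (simp add: dR m_def)
  let ?K = "adjoin fract_consts {f}"
  note clK = division_subring_closed[OF division_subring_adjoin[of fract_consts "{f}"]]
  have kK: "to_fract [:c:] \<in> ?K" for c using adjoin_base by fast
  have fK: "f \<in> ?K" using adjoin_gen by fast
  have RK: "coeffs_in ?K R"
    unfolding coeffs_in_def R_def coeff_G'[OF uv(1)] uv(3)[symmetric]
    using kK fK by (blast intro: clK)
  have KE: "?K \<subseteq> E" using E fE by (intro adjoin_least) auto
  have "E \<subseteq> ?K"
  proof
    fix e assume e: "e \<in> E"
    obtain a b where ab: "b \<noteq> 0" "e = to_fract a / to_fract b" using quot[of e] by blast
    \<comment> \<open>Instead of comparing field degrees, numerator and denominator of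
      \<open>e\<close> are reduced modulo \<open>R\<close> to degree below \<open>m\<close>. Then
      \<open>a' - e b'\<close> has the root \<open>t\<close> and too small a degree, so it is
      \<open>0\<close> and \<open>e\<close> is a ratio of coefficients in
      \<open>k(f)\<close>.\<close>
    have red: "\<exists>r. coeffs_in ?K r \<and> poly r t = to_fract q \<and> (r = 0 \<or> degree r < m)" for q
    proof -
      have "coeffs_in ?K (fract_poly (cst q))" using kK by (simp add: coeffs_in_def coeff_map_poly)
      from coeffs_in_division[OF division_subring_adjoin RK _ this]
      obtain s r where "coeffs_in ?K r" "fract_poly (cst q) = s * R + r" "r = 0 \<or> degree r < m"
        using RA dRm by (auto simp: A_def)
      moreover from this have "poly r t = to_fract q"
        using RA cst_t[of q] by (simp add: A_def)
      ultimately show ?thesis by blast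
    qed
    obtain a' where a': "coeffs_in ?K a'" "poly a' t = to_fract a" "a' = 0 \<or> degree a' < m"
      using red[of a] by blast
    obtain b' where b': "coeffs_in ?K b'" "poly b' t = to_fract b" "b' = 0 \<or> degree b' < m"
      using red[of b] by blast
    have "a' - smult e b' = 0"
    proof (rule ccontr)
      assume nz: "a' - smult e b' \<noteq> 0"
      have "poly (a' - smult e b') t = 0" using a' b' ab by simp
      moreover have "coeffs_in E (a' - smult e b')"
        using a' b' e KE by (auto simp: coeffs_in_def intro!: cl)
      ultimately have "m \<le> degree (a' - smult e b')" using Mmin nz degM by (auto simp: A_def)
      moreover have "degree (a' - smult e b') < m"
        using a'(3) b'(3) nz by (auto intro!: degree_diff_less le_less_trans[OF degree_smult_le])
      ultimately show False by simp
    qed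
    moreover have "b' \<noteq> 0" using b' ab by auto
    then obtain j where j: "coeff b' j \<noteq> 0" by (metis leading_coeff_0_iff)
    ultimately have "e = coeff a' j / coeff b' j"
      by (simp add: poly_eq_iff)
    then show "e \<in> ?K" using a' b' by (auto simp: coeffs_in_def intro!: clK)
  qed
  then show ?thesis using fE by blast
qed

section \<open>Places\<close>

text \<open>Partial ring homomorphisms are represented by their graphs.\<close>

locale partial_hom =
  fixes \<rho> :: "'a::division_ring \<Rightarrow> 'b::division_ring \<Rightarrow> bool"
  assumes functional: "\<rho> x y \<Longrightarrow> \<rho> x z \<Longrightarrow> y = z"
    and one: "\<rho> 1 1"
    and diff: "\<rho> x y \<Longrightarrow> \<rho> x' y' \<Longrightarrow> \<rho> (x - x') (y - y')"
    and mult: "\<rho> x y \<Longrightarrow> \<rho> x' y' \<Longrightarrow> \<rho> (x * x') (y * y')"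
begin

lemma zero: "\<rho> 0 0"
  using diff[OF one one] by simp

lemma add: "\<rho> x y \<Longrightarrow> \<rho> x' y' \<Longrightarrow> \<rho> (x + x') (y + y')"
  using diff[of x y "- x'" "- y'"] diff[OF zero, of x' y'] by simp

lemma power: "\<rho> x y \<Longrightarrow> \<rho> (x ^ n) (y ^ n)"
  by (induction n) (auto intro: one mult)

lemma sum: "(\<And>i. i \<in> I \<Longrightarrow> \<rho> (f i) (g i)) \<Longrightarrow> \<rho> (sum f I) (sum g I)"
  by (induction I rule: infinite_finite_induct) (auto intro: zero add)

lemma inverse:
  assumes "\<rho> x y" "\<rho> (inverse x) z"
  shows "z = inverse y"
proof (cases "x = 0")
  case True
  then show ?thesis using assms functional[OF zero] by (metis inverse_zero)
next
  case False
  then have "y * z = 1" using mult[OF assms] functional[OF one] by auto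
  then show ?thesis by (simp add: inverse_unique)
qed

lemma division_subring_image:
  assumes "division_subring E" and dom: "\<And>x. x \<in> E \<Longrightarrow> \<exists>y. \<rho> x y"
  shows "division_subring {y. \<exists>x\<in>E. \<rho> x y}"
proof (rule division_subringI, goal_cases)
  case 1
  show ?case using one division_subring_1[OF assms(1)] by blast
next
  case (2 x y)
  then show ?case using diff division_subring_diff[OF assms(1)] by blast
next
  case (3 x y)
  then show ?case using mult division_subring_mult[OF assms(1)] by blast
next
  case (4 y)
  then obtain x where "x \<in> E" "\<rho> x y" by blast
  moreover from this obtain z where "\<rho> (inverse x) z"
    using dom division_subring_inverse[OF assms(1)] by blast
  ultimately show ?case
    using inverse[of x y z] division_subring_inverse[OF assms(1)] by blast
qed

lemma division_subring_preimage:
  assumes "division_subring F" and dom: "\<And>x. x \<in> F \<Longrightarrow> \<exists>y. \<rho> x y" and "division_subring M"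
  shows "division_subring {x\<in>F. \<exists>y\<in>M. \<rho> x y}"
proof (rule division_subringI, goal_cases)
  case 1
  show ?case using one assms(1,3) by (auto intro: division_subring_1)
next
  case (2 x y)
  then show ?case using assms(1,3) by (auto intro!: division_subring_diff intro: diff)
next
  case (3 x y)
  then show ?case using assms(1,3) by (auto intro!: division_subring_mult intro: mult)
next
  case (4 x)
  then obtain y where y: "x \<in> F" "\<rho> x y" "y \<in> M" by blast
  then have iF: "inverse x \<in> F" using assms(1) by (simp add: division_subring_inverse)
  then obtain z where z: "\<rho> (inverse x) z" using dom by blast
  then have "z \<in> M" using inverse[OF y(2) z] y assms(3) by (simp add: division_subring_inverse)
  then show ?case using z iF by blast
qed

text \<open>A nonzero difference sent to \<open>0\<close> has an inverse with an image, so
  \<open>1\<close> would be sent to \<open>0\<close>.\<close>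

lemma inj_on_division_subring:
  assumes "division_subring E" and dom: "\<And>x. x \<in> E \<Longrightarrow> \<exists>y. \<rho> x y"
    and "x \<in> E" "x' \<in> E" "\<rho> x y" "\<rho> x' y"
  shows "x = x'"
proof (rule ccontr)
  assume ne: "x \<noteq> x'"
  have E: "x - x' \<in> E" using assms by (simp add: division_subring_diff)
  then obtain z where z: "\<rho> (inverse (x - x')) z"
    using dom division_subring_inverse[OF assms(1)] by blast
  have "\<rho> (x - x') 0" using diff[OF assms(5,6)] by simp
  from mult[OF this z] have "\<rho> 1 0" using ne by simp
  then show False using functional[OF one] by force
qed

end

lemma partial_hom_OO:
  assumes "partial_hom \<rho>" "partial_hom \<tau>"
  shows "partial_hom (\<rho> OO \<tau>)"
proof -
  interpret r: partial_hom \<rho> by fact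
  interpret t: partial_hom \<tau> by fact
  show ?thesis
  proof (unfold_locales, goal_cases)
    case (1 x y z)
    then show ?case using r.functional t.functional by blast
  next
    case 2
    show ?case using r.one t.one by blast
  next
    case (3 x y x' y')
    then show ?case using r.diff t.diff by blast
  next
    case (4 x y x' y')
    then show ?case using r.mult t.mult by blast
  qed
qed

text \<open>The value infinity is encoded by absence from the domain and may occur only where the
  inverse is sent to \<open>0\<close>.\<close>

locale place = partial_hom +
  assumes total: "(\<exists>y. \<rho> x y) \<or> \<rho> (inverse x) 0"
begin

text \<open>Otherwise \<open>inverse x\<close> is sent to \<open>0\<close>, so the equation divided by \<open>x ^ r\<close> would be sent to \<open>1 = 0\<close>.\<close>

lemma integral_in_dom:
  assumes c: "\<And>j. j < r \<Longrightarrow> \<exists>y. \<rho> (c j) y" and eq: "x ^ r + (\<Sum>j<r. c j * x ^ j) = 0"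
  shows "\<exists>y. \<rho> x y"
proof (rule ccontr)
  assume nd: "\<not> (\<exists>y. \<rho> x y)"
  then have i0: "\<rho> (inverse x) 0" using total by blast
  have x0: "x \<noteq> 0" using nd zero by auto
  obtain d where d: "\<And>j. j < r \<Longrightarrow> \<rho> (c j) (d j)" using c by metis
  have "0 = (x ^ r + (\<Sum>j<r. c j * x ^ j)) * inverse x ^ r"
    by (simp add: eq)
  also have "\<dots> = 1 + (\<Sum>j<r. c j * inverse x ^ (r - j))"
  proof -
    have "x ^ j * inverse x ^ r = inverse x ^ (r - j)" if "j \<le> r" for j
    proof -
      have "inverse x ^ r = inverse x ^ j * inverse x ^ (r - j)"
        using that by (simp flip: power_add)
      moreover have "x ^ j * inverse x ^ j = 1"
        using x0 by (simp add: power_inverse)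
      ultimately show ?thesis by (metis mult.assoc mult.left_neutral)
    qed
    from this[of r] this show ?thesis
      by (simp add: distrib_right sum_distrib_right mult.assoc)
  qed
  finally have "\<rho> (1 + (\<Sum>j<r. c j * inverse x ^ (r - j))) 0" using zero by simp
  moreover have "\<rho> (1 + (\<Sum>j<r. c j * inverse x ^ (r - j))) (1 + (\<Sum>j<r. d j * 0 ^ (r - j)))"
    by (intro add one sum mult power i0 d) auto
  moreover have "(\<Sum>j<r. d j * 0 ^ (r - j)) = 0"
    by (rule sum.neutral) (auto simp: power_0_left)
  ultimately show False using functional by fastforce
qed

end

subsection \<open>The place given by lowest terms\<close>

text \<open>A bound on the order of vanishing, in a form that also covers \<open>0\<close>, which
  has no lowest exponent.\<close>

definition keys_above :: "'m::ord \<Rightarrow> ('m \<Rightarrow>\<^sub>0 'c::zero) \<Rightarrow> bool" where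
  "keys_above m s \<longleftrightarrow> (\<forall>x\<in>Poly_Mapping.keys s. m \<le> x)"

lemma keys_above_diff:
  fixes s t :: "'m::linorder \<Rightarrow>\<^sub>0 'c::ab_group_add"
  shows "keys_above m s \<Longrightarrow> keys_above m t \<Longrightarrow> keys_above m (s - t)"
  using keys_diff[of s t] by (auto simp: keys_above_def)

text \<open>The exponent \<open>m + m'\<close> arises only from the pair of \<open>m\<close> and
  \<open>m'\<close>, since enlarging one of them enlarges the sum. Both are mere lower bounds, so
  the coefficients there may be \<open>0\<close>.\<close>

lemma keys_above_mult:
  fixes s s' :: "'m::{ordered_cancel_comm_monoid_add,linorder} \<Rightarrow>\<^sub>0 'c::comm_ring_1"
  assumes "keys_above m s" "keys_above m' s'"
  shows "keys_above (m + m') (s * s')"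
    and "Poly_Mapping.lookup (s * s') (m + m') = Poly_Mapping.lookup s m * Poly_Mapping.lookup s' m'"
proof -
  show "keys_above (m + m') (s * s')"
    using assms keys_mult[of s s'] by (fastforce simp: keys_above_def intro: add_mono)
  define s1 where "s1 = s - Poly_Mapping.single m (Poly_Mapping.lookup s m)"
  define s1' where "s1' = s' - Poly_Mapping.single m' (Poly_Mapping.lookup s' m')"
  have k: "m < x" if "x \<in> Poly_Mapping.keys s1" for x
  proof -
    have "x \<noteq> m" using that by (auto simp: s1_def in_keys_iff lookup_minus lookup_single)
    moreover from this have "x \<in> Poly_Mapping.keys s"
      using that by (auto simp: s1_def in_keys_iff lookup_minus lookup_single)
    ultimately show ?thesis using assms by (auto simp: keys_above_def order.strict_iff_order)
  qed
  have k': "m' < x" if "x \<in> Poly_Mapping.keys s1'" for x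
  proof -
    have "x \<noteq> m'" using that by (auto simp: s1'_def in_keys_iff lookup_minus lookup_single)
    moreover from this have "x \<in> Poly_Mapping.keys s'"
      using that by (auto simp: s1'_def in_keys_iff lookup_minus lookup_single)
    ultimately show ?thesis using assms by (auto simp: keys_above_def order.strict_iff_order)
  qed
  have z1: "m + m' \<notin> Poly_Mapping.keys (s1 * s')"
  proof
    assume "m + m' \<in> Poly_Mapping.keys (s1 * s')"
    then obtain a b where ab: "a \<in> Poly_Mapping.keys s1" "b \<in> Poly_Mapping.keys s'" "m + m' = a + b"
      using keys_mult[of s1 s'] by blast
    have "m < a" "m' \<le> b" using ab k assms(2) by (auto simp: keys_above_def)
    from add_less_le_mono[OF this] show False using ab by simp
  qed
  have z2: "m + m' \<notin> Poly_Mapping.keys (Poly_Mapping.single m (Poly_Mapping.lookup s m) * s1')"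
  proof
    let ?M = "Poly_Mapping.single m (Poly_Mapping.lookup s m)"
    assume "m + m' \<in> Poly_Mapping.keys (?M * s1')"
    then obtain a b where ab: "a \<in> Poly_Mapping.keys ?M" "b \<in> Poly_Mapping.keys s1'" "m + m' = a + b"
      using keys_mult[of ?M s1'] by blast
    have "m = a" using ab(1) by (simp split: if_splits)
    then show False using ab k' by auto
  qed
  have "s * s' = s1 * s' + Poly_Mapping.single m (Poly_Mapping.lookup s m) * s1'
      + Poly_Mapping.single m (Poly_Mapping.lookup s m) * Poly_Mapping.single m' (Poly_Mapping.lookup s' m')"
    by (simp add: s1_def s1'_def algebra_simps)
  then show "Poly_Mapping.lookup (s * s') (m + m') = Poly_Mapping.lookup s m * Poly_Mapping.lookup s' m'"
    using z1 z2 by (simp add: lookup_add mult_single in_keys_iff)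
qed

definition low :: "('m::linorder \<Rightarrow>\<^sub>0 'c::zero) \<Rightarrow> 'm" where
  "low s = Min (Poly_Mapping.keys s)"

lemma keys_above_low: "keys_above (low s) s"
  by (simp add: keys_above_def low_def)

lemma lookup_low: "s \<noteq> 0 \<Longrightarrow> Poly_Mapping.lookup s (low s) \<noteq> 0"
  unfolding low_def in_keys_iff[symmetric] by (intro Min_in) auto

lemma low_eqI: "keys_above m s \<Longrightarrow> Poly_Mapping.lookup s m \<noteq> 0 \<Longrightarrow> low s = m"
  unfolding low_def keys_above_def by (intro Min_eqI) (auto simp: in_keys_iff)

lemma low_mult:
  fixes s t :: "'m::{ordered_cancel_comm_monoid_add,linorder} \<Rightarrow>\<^sub>0 'c::idom"
  assumes "s \<noteq> 0" "t \<noteq> 0"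
  shows "low (s * t) = low s + low t"
  using assms by (intro low_eqI) (simp_all add: keys_above_mult keys_above_low lookup_low)

text \<open>The residue map of the valuation by lowest exponents. Both coefficients are read off at
  the lowest exponent of \<open>b\<close>, so a numerator of larger order gives \<open>0\<close>.
  The exponents are linearly ordered, hence the residue is a fraction of single
  coefficients.\<close>

definition low_place ::
    "('m::{ordered_cancel_comm_monoid_add,linorder} \<Rightarrow>\<^sub>0 'c::idom) fract \<Rightarrow> 'c fract \<Rightarrow> bool" where
  "low_place x y \<longleftrightarrow> (\<exists>a b. b \<noteq> 0 \<and> keys_above (low b) a \<and> x = Fract a b \<and>
     y = Fract (Poly_Mapping.lookup a (low b)) (Poly_Mapping.lookup b (low b)))"

lemma low_placeI:
  "b \<noteq> 0 \<Longrightarrow> keys_above (low b) a \<Longrightarrow>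
    low_place (Fract a b) (Fract (Poly_Mapping.lookup a (low b)) (Poly_Mapping.lookup b (low b)))"
  unfolding low_place_def by blast

text \<open>The laws reduce to multiplicativity of lowest coefficients. If \<open>a / b\<close> has
  no image, then \<open>low a < low b\<close>, so \<open>b\<close> has coefficient \<open>0\<close>
  at \<open>low a\<close> and \<open>b / a\<close> is sent to \<open>0\<close>.\<close>

lemma place_low_place:
  "place (low_place :: ('m::{ordered_cancel_comm_monoid_add,linorder} \<Rightarrow>\<^sub>0 'c::idom) fract \<Rightarrow> _)"
proof (unfold_locales, goal_cases)
  case (1 x y z)
  obtain a b where ab: "b \<noteq> 0" "keys_above (low b) a" "x = Fract a b"
    "y = Fract (Poly_Mapping.lookup a (low b)) (Poly_Mapping.lookup b (low b))"
    using 1(1) unfolding low_place_def by blast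
  obtain c d where cd: "d \<noteq> 0" "keys_above (low d) c" "x = Fract c d"
    "z = Fract (Poly_Mapping.lookup c (low d)) (Poly_Mapping.lookup d (low d))"
    using 1(2) unfolding low_place_def by blast
  have "a * d = c * b" using ab cd by (simp add: eq_fract)
  then have "Poly_Mapping.lookup (a * d) (low b + low d) = Poly_Mapping.lookup (c * b) (low d + low b)"
    by (simp add: add.commute)
  then have "Poly_Mapping.lookup a (low b) * Poly_Mapping.lookup d (low d) = Poly_Mapping.lookup c (low d) * Poly_Mapping.lookup b (low b)"
    using ab cd by (simp add: keys_above_mult keys_above_low)
  then show ?case using ab cd by (simp add: eq_fract lookup_low)
next
  case 2
  \<comment> \<open>Dividing the lowest coefficient of \<open>1\<close> by itself avoids computing
    \<open>low 1\<close>.\<close>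
  let ?c = "Poly_Mapping.lookup (1 :: 'm \<Rightarrow>\<^sub>0 'c) (low (1 :: 'm \<Rightarrow>\<^sub>0 'c))"
  have "low_place (Fract (1 :: 'm \<Rightarrow>\<^sub>0 'c) 1) (Fract ?c ?c)"
    by (rule low_placeI[OF one_neq_zero keys_above_low])
  moreover have "?c \<noteq> 0" by (rule lookup_low[OF one_neq_zero])
  then have "Fract ?c ?c = 1" by (simp add: One_fract_def eq_fract)
  ultimately show ?case by (simp add: One_fract_def)
next
  case (3 x y x' y')
  obtain a b where ab: "b \<noteq> 0" "keys_above (low b) a" "x = Fract a b"
    "y = Fract (Poly_Mapping.lookup a (low b)) (Poly_Mapping.lookup b (low b))"
    using 3(1) unfolding low_place_def by blast
  obtain c d where cd: "d \<noteq> 0" "keys_above (low d) c" "x' = Fract c d"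
    "y' = Fract (Poly_Mapping.lookup c (low d)) (Poly_Mapping.lookup d (low d))"
    using 3(2) unfolding low_place_def by blast
  have "keys_above (low (b * d)) (a * d - c * b)"
    using ab cd keys_above_mult(1)[OF ab(2) keys_above_low[of d]]
      keys_above_mult(1)[OF cd(2) keys_above_low[of b]]
    by (auto simp: low_mult add.commute intro: keys_above_diff)
  from low_placeI[OF _ this] have
    "low_place (Fract (a * d - c * b) (b * d))
       (Fract (Poly_Mapping.lookup (a * d - c * b) (low (b * d))) (Poly_Mapping.lookup (b * d) (low (b * d))))"
    using ab cd by simp
  moreover have "Poly_Mapping.lookup (a * d - c * b) (low (b * d))
      = Poly_Mapping.lookup a (low b) * Poly_Mapping.lookup d (low d) - Poly_Mapping.lookup c (low d) * Poly_Mapping.lookup b (low b)"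
    using ab cd keys_above_mult(2)[OF ab(2) keys_above_low[of d]]
      keys_above_mult(2)[OF cd(2) keys_above_low[of b]]
    by (simp add: low_mult lookup_minus add.commute)
  moreover have "Poly_Mapping.lookup (b * d) (low (b * d)) = Poly_Mapping.lookup b (low b) * Poly_Mapping.lookup d (low d)"
    using ab cd by (simp add: low_mult keys_above_mult keys_above_low)
  ultimately show ?case using ab cd by (simp add: diff_fract lookup_low)
next
  case (4 x y x' y')
  obtain a b where ab: "b \<noteq> 0" "keys_above (low b) a" "x = Fract a b"
    "y = Fract (Poly_Mapping.lookup a (low b)) (Poly_Mapping.lookup b (low b))"
    using 4(1) unfolding low_place_def by blast
  obtain c d where cd: "d \<noteq> 0" "keys_above (low d) c" "x' = Fract c d"
    "y' = Fract (Poly_Mapping.lookup c (low d)) (Poly_Mapping.lookup d (low d))"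
    using 4(2) unfolding low_place_def by blast
  have "keys_above (low (b * d)) (a * c)"
    using ab cd by (simp add: low_mult keys_above_mult)
  from low_placeI[OF _ this] show ?case
    using ab cd by (simp add: low_mult keys_above_mult keys_above_low)
next
  case (5 x)
  obtain a b where ab: "b \<noteq> 0" "x = Fract a b" by (cases x) blast
  show ?case
  proof (cases "keys_above (low b) a")
    case True
    then show ?thesis using ab low_placeI by blast
  next
    case False
    then have "a \<noteq> 0" by (auto simp: keys_above_def)
    have lt: "low a < low b"
      using False keys_above_low[of a] unfolding keys_above_def
      by (meson dual_order.trans linorder_le_less_linear)
    have "keys_above (low a) b"
      using lt keys_above_low[of b] unfolding keys_above_def by force
    from low_placeI[OF \<open>a \<noteq> 0\<close> this]
    have "low_place (inverse x) (Fract (Poly_Mapping.lookup b (low a)) (Poly_Mapping.lookup a (low a)))" using ab by simp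
    moreover have "Poly_Mapping.lookup b (low a) = 0"
    proof (rule ccontr)
      assume "Poly_Mapping.lookup b (low a) \<noteq> 0"
      then have "low a \<in> Poly_Mapping.keys b" by (simp add: in_keys_iff)
      then show False using lt keys_above_low[of b] by (force simp: keys_above_def)
    qed
    ultimately show ?thesis by (simp add: Zero_fract_def[symmetric] fract_collapse)
  qed
qed

text \<open>If the denominator has a nonzero constant term, taking lowest terms means setting all
  variables to \<open>0\<close>.\<close>

lemma low_place_0:
  fixes a b :: "'m::{ordered_cancel_comm_monoid_add,linorder} \<Rightarrow>\<^sub>0 'c::idom"
  assumes "\<And>m::'m. 0 \<le> m" "Poly_Mapping.lookup b 0 \<noteq> 0"
  shows "low_place (Fract a b) (Fract (Poly_Mapping.lookup a 0) (Poly_Mapping.lookup b 0))"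
proof -
  have "keys_above 0 s" for s :: "'m \<Rightarrow>\<^sub>0 'c" using assms(1) by (simp add: keys_above_def)
  moreover from this have "low b = 0" using assms(2) by (intro low_eqI)
  moreover have "b \<noteq> 0" using assms(2) by auto
  ultimately show ?thesis using low_placeI[of b a] by metis
qed

section \<open>Places of simple transcendental extensions\<close>

text \<open>Rational root argument: for \<open>u / v\<close> in lowest terms, a relation cleared of
  denominators makes \<open>v\<close> divide its leading coefficient, so \<open>v\<close> is
  constant. Then \<gamma> is a nonconstant polynomial, and composition with it kills no nonzero
  polynomial.\<close>

lemma nonconst_transcendental:
  fixes p :: "'k::field_gcd poly"
  assumes "\<gamma> \<notin> fract_consts" "p \<noteq> 0"
  shows "poly (map_poly (\<lambda>c. to_fract [:c:]) p) \<gamma> \<noteq> 0"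
proof
  let ?c = "\<lambda>c::'k. to_fract [:c:]"
  assume z: "poly (map_poly ?c p) \<gamma> = 0"
  define u v where "u = fst (quot_of_fract \<gamma>)" and "v = snd (quot_of_fract \<gamma>)"
  have uv: "v \<noteq> 0" "coprime u v" "\<gamma> = to_fract u / to_fract v"
    using coprime_quot_of_fract[of \<gamma>] by (simp_all add: u_def v_def flip: Fract_conv_to_fract)
  define n where "n = degree p"
  have deg: "degree (map_poly ?c p) = n" by (simp add: n_def degree_map_poly)
  have "to_fract (\<Sum>i\<le>n. [:coeff p i:] * u ^ i * v ^ (n - i))
      = to_fract v ^ n * poly (map_poly ?c p) \<gamma>"
  proof -
    have pw: "to_fract (x ^ k) = to_fract x ^ k" for x :: "'k poly" and k
      by (induction k) simp_all
    have "to_fract v ^ n * (?c (coeff p i) * \<gamma> ^ i) = to_fract ([:coeff p i:] * u ^ i * v ^ (n - i))"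
      if "i \<le> n" for i
    proof -
      have "to_fract v ^ n = to_fract v ^ i * to_fract v ^ (n - i)"
        using that by (simp flip: power_add)
      moreover have "to_fract v ^ i * \<gamma> ^ i = to_fract u ^ i"
        using uv by (simp flip: power_mult_distrib)
      ultimately show ?thesis unfolding to_fract_mult pw by (simp add: algebra_simps)
    qed
    then show ?thesis
      unfolding poly_altdef deg sum_distrib_left to_fract_sum
      by (intro sum.cong) (simp_all add: coeff_map_poly)
  qed
  then have S0: "(\<Sum>i\<le>n. [:coeff p i:] * u ^ i * v ^ (n - i)) = 0"
    unfolding z mult_zero_right to_fract_eq_0_iff .
  \<comment> \<open>Every term with \<open>i < n\<close> contains a positive power of
    \<open>v\<close>.\<close>
  define S where "S = (\<Sum>i<n. [:coeff p i:] * u ^ i * v ^ (n - i))"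
  have "(\<Sum>i\<le>n. [:coeff p i:] * u ^ i * v ^ (n - i)) = S + [:coeff p n:] * u ^ n"
    by (simp add: lessThan_Suc_atMost[symmetric] S_def)
  then have "[:coeff p n:] * u ^ n = - S"
    unfolding S0 by (simp only: eq_neg_iff_add_eq_0 add.commute)
  moreover have "v dvd S"
    unfolding S_def by (intro dvd_sum dvd_mult) (simp add: dvd_power)
  ultimately have "v dvd [:coeff p n:] * u ^ n"
    by (simp only: dvd_minus_iff)
  moreover have "coprime v (u ^ n)" using uv(2) by (simp add: coprime_commute)
  ultimately have "v dvd [:coeff p n:]" by (simp only: coprime_dvd_mult_left_iff)
  moreover have "coeff p n \<noteq> 0" using assms(2) by (simp add: n_def)
  ultimately have "degree v = 0" by (metis degree_pCons_0 dvd_imp_degree_le le_zero_eq pCons_eq_0_iff)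
  then obtain d where d: "v = [:d:]" "d \<noteq> 0" using uv(1) by (metis degree_eq_zeroE pCons_0_0)
  define w where "w = smult (inverse d) u"
  have "u = v * w" using d by (simp add: w_def)
  then have g: "\<gamma> = to_fract w" using uv by simp
  have "degree w \<noteq> 0"
  proof
    assume "degree w = 0"
    then obtain e where "w = [:e:]" by (metis degree_eq_zeroE)
    then show False using g assms(1) by auto
  qed
  have "poly (map_poly ?c q) (to_fract w) = to_fract (pcompose q w)" for q
  proof (induction q)
    case (pCons a q)
    have "to_fract (pcompose (pCons a q) w) = to_fract [:a:] + to_fract w * to_fract (pcompose q w)"
      by (simp only: pcompose_pCons to_fract_add to_fract_mult)
    then show ?case using pCons by (simp add: map_poly_pCons)
  qed simp
  then have "pcompose p w = 0" using z g by simp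
  then show False using pcompose_eq_0[of p w] \<open>degree w \<noteq> 0\<close> assms(2) by simp
qed

locale const_embedding =
  fixes c :: "'k::field \<Rightarrow> 'a::field"
  assumes c_1: "c 1 = 1" and c_diff: "c (x - y) = c x - c y" and c_mult: "c (x * y) = c x * c y"
begin

lemma c_0: "c 0 = 0"
  using c_diff[of 0 0] by simp

lemma c_add: "c (x + y) = c x + c y"
  using c_diff[of x "- y"] c_diff[of 0 y] by (simp add: c_0)

lemma poly_c_diff: "poly (map_poly c (p - q)) g = poly (map_poly c p) g - poly (map_poly c q) g"
proof -
  have "map_poly c (p - q) = map_poly c p - map_poly c q"
    by (intro poly_eqI) (simp add: coeff_map_poly c_0 c_diff)
  then show ?thesis by simp
qed

lemma poly_c_mult: "poly (map_poly c (p * q)) g = poly (map_poly c p) g * poly (map_poly c q) g"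
proof -
  have "c (sum f A) = (\<Sum>x\<in>A. c (f x))" for f :: "nat \<Rightarrow> 'k" and A
    by (induction A rule: infinite_finite_induct) (simp_all add: c_0 c_add)
  then have "map_poly c (p * q) = map_poly c p * map_poly c q"
    by (intro poly_eqI) (simp add: coeff_map_poly c_0 c_mult coeff_mult)
  then show ?thesis by simp
qed

text \<open>Transcendence of \<open>g\<close> keeps the denominators nonzero, so differences can be
  brought to a common denominator.\<close>

lemma adjoin_subset_quotients:
  assumes nz: "\<And>p. p \<noteq> 0 \<Longrightarrow> poly (map_poly c p) g \<noteq> 0"
  shows "adjoin (range c) {g} \<subseteq> {poly (map_poly c p) g / poly (map_poly c q) g | p q. q \<noteq> 0}"
proof (rule adjoin_least)
  show "division_subring {poly (map_poly c p) g / poly (map_poly c q) g | p q. q \<noteq> 0}"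
  proof (rule division_subringI, goal_cases)
    case 1
    show ?case by (intro CollectI exI[of _ 1]) (simp add: map_poly_1 c_1)
  next
    case (2 x y)
    then obtain p q p' q' where *: "x = poly (map_poly c p) g / poly (map_poly c q) g"
      "y = poly (map_poly c p') g / poly (map_poly c q') g" "q \<noteq> 0" "q' \<noteq> 0" by blast
    then have "x - y = poly (map_poly c (p * q' - p' * q)) g / poly (map_poly c (q * q')) g"
      using nz by (simp add: poly_c_diff poly_c_mult diff_frac_eq)
    moreover have "q * q' \<noteq> 0" using * by simp
    ultimately show ?case by blast
  next
    case (3 x y)
    then obtain p q p' q' where *: "x = poly (map_poly c p) g / poly (map_poly c q) g"
      "y = poly (map_poly c p') g / poly (map_poly c q') g" "q \<noteq> 0" "q' \<noteq> 0" by blast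
    then have "x * y = poly (map_poly c (p * p')) g / poly (map_poly c (q * q')) g"
      by (simp add: poly_c_mult)
    moreover have "q * q' \<noteq> 0" using * by simp
    ultimately show ?case by blast
  next
    case (4 x)
    then obtain p q where *: "x = poly (map_poly c p) g / poly (map_poly c q) g" "q \<noteq> 0" by blast
    then have "p \<noteq> 0" using 4 by auto
    moreover have "inverse x = poly (map_poly c q) g / poly (map_poly c p) g" using * by simp
    ultimately show ?case by blast
  qed
  show "range c \<subseteq> {poly (map_poly c p) g / poly (map_poly c q) g | p q. q \<noteq> 0}"
  proof safe
    fix a
    show "\<exists>p q. c a = poly (map_poly c p) g / poly (map_poly c q) g \<and> q \<noteq> 0"
      by (intro exI[of _ "[:a:]"] exI[of _ 1]) (simp add: map_poly_1 map_poly_pCons c_0 c_1)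
  qed
  have "g = poly (map_poly c [:0, 1:]) g / poly (map_poly c 1) g"
    by (simp add: map_poly_1 map_poly_pCons c_0 c_1)
  then show "{g} \<subseteq> {poly (map_poly c p) g / poly (map_poly c q) g | p q. q \<noteq> 0}"
    by (metis (mono_tags, lifting) mem_Collect_eq one_neq_zero singletonD subsetI)
qed

end


text \<open>A polynomial in \<open>g\<close> is sent to the same polynomial in \<gamma>, which is
  nonzero by transcendence; so the place kills no denominator.\<close>

lemma place_adjoin_dom:
  fixes c :: "'k::field_gcd \<Rightarrow> 'a::field" and \<rho> :: "'a \<Rightarrow> 'k poly fract \<Rightarrow> bool"
  assumes "place \<rho>" "const_embedding c"
    and c: "\<And>a. \<rho> (c a) (to_fract [:a:])" and g: "\<rho> g \<gamma>" "\<gamma> \<notin> fract_consts"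
    and x: "x \<in> adjoin (range c) {g}"
  shows "\<exists>y. \<rho> x y"
proof -
  interpret place \<rho> by fact
  interpret const_embedding c by fact
  let ?d = "\<lambda>a::'k. to_fract [:a:]"
  have \<rho>p: "\<rho> (poly (map_poly c p) g) (poly (map_poly ?d p) \<gamma>)" for p
  proof (induction p)
    case 0
    show ?case using zero by simp
  next
    case (pCons a p)
    then show ?case by (simp add: map_poly_pCons c_0) (intro add mult c g)
  qed
  have nz: "poly (map_poly c p) g \<noteq> 0" if "p \<noteq> 0" for p
    using \<rho>p[of p] nonconst_transcendental[OF g(2) that] functional[OF zero] by force
  obtain p q where pq: "x = poly (map_poly c p) g / poly (map_poly c q) g" "q \<noteq> 0"
    using adjoin_subset_quotients[OF nz] x by blast
  obtain z where "\<rho> (inverse (poly (map_poly c q) g)) z"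
  proof (cases "\<exists>y. \<rho> (inverse (poly (map_poly c q) g)) y")
    \<comment> \<open>By totality, a denominator whose inverse has no image is itself sent to
      \<open>0\<close>.\<close>
    case False
    then have "\<rho> (inverse (inverse (poly (map_poly c q) g))) 0" using total by blast
    then have "poly (map_poly ?d q) \<gamma> = 0" using functional \<rho>p[of q] by auto
    then show ?thesis using nonconst_transcendental[OF g(2) pq(2)] by simp
  qed blast
  from mult[OF \<rho>p[of p] this] show ?thesis using pq by (auto simp: divide_inverse)
qed

section \<open>Left linear algebra over division subrings\<close>

definition left_span :: "'a::division_ring set \<Rightarrow> 'a set \<Rightarrow> 'a set" where
  "left_span K B = {\<Sum>b\<in>B. c b * b | c. \<forall>b\<in>B. c b \<in> K}"

lemma left_spanI: "(\<And>b. b \<in> B \<Longrightarrow> c b \<in> K) \<Longrightarrow> (\<Sum>b\<in>B. c b * b) \<in> left_span K B"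
  by (auto simp: left_span_def)

lemma left_span_diff:
  assumes "division_subring K" "x \<in> left_span K B" "y \<in> left_span K B"
  shows "x - y \<in> left_span K B"
proof -
  obtain c d where "\<forall>b\<in>B. c b \<in> K" "x = (\<Sum>b\<in>B. c b * b)" "\<forall>b\<in>B. d b \<in> K" "y = (\<Sum>b\<in>B. d b * b)"
    using assms(2,3) by (auto simp: left_span_def)
  moreover from this have "x - y = (\<Sum>b\<in>B. (c b - d b) * b)"
    by (simp add: sum_subtractf left_diff_distrib)
  ultimately show ?thesis using assms(1)
    by (auto intro!: left_spanI division_subring_diff)
qed

lemma left_span_0: "division_subring K \<Longrightarrow> 0 \<in> left_span K B"
  using left_spanI[of B "\<lambda>_. 0" K] by (simp add: division_subring_0)

lemma left_span_add:
  assumes "division_subring K" "x \<in> left_span K B" "y \<in> left_span K B"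
  shows "x + y \<in> left_span K B"
  using left_span_diff[OF assms(1,2) left_span_diff[OF assms(1) left_span_0[OF assms(1)] assms(3)]]
  by simp

lemma left_span_sum:
  assumes "division_subring K" "\<And>i. i \<in> I \<Longrightarrow> f i \<in> left_span K B"
  shows "sum f I \<in> left_span K B"
  using assms by (induction I rule: infinite_finite_induct) (auto intro: left_span_0 left_span_add)

lemma left_span_scale:
  assumes "division_subring K" "a \<in> K" "x \<in> left_span K B"
  shows "a * x \<in> left_span K B"
proof -
  obtain c where "\<forall>b\<in>B. c b \<in> K" "x = (\<Sum>b\<in>B. c b * b)"
    using assms(3) by (auto simp: left_span_def)
  moreover from this have "a * x = (\<Sum>b\<in>B. (a * c b) * b)"
    by (simp add: sum_distrib_left mult.assoc)
  ultimately show ?thesis using assms(1,2)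
    by (auto intro!: left_spanI division_subring_mult)
qed

text \<open>Elimination of the coordinate \<open>b\<close> by a pivot \<open>v p\<close>, with all
  multipliers on the left. The vectors form a family over \<open>J\<close>, so coinciding powers of
  an element count as dependent.\<close>

lemma left_dependent:
  assumes K: "division_subring K" and "finite B" and "finite J" "card B < card J"
    and "\<And>j. j \<in> J \<Longrightarrow> v j \<in> left_span K B"
  shows "\<exists>c. (\<forall>j\<in>J. c j \<in> K) \<and> (\<exists>j\<in>J. c j \<noteq> 0) \<and> (\<Sum>j\<in>J. c j * v j) = 0"
  using assms(2-)
proof (induction B arbitrary: J v rule: finite_induct)
  case empty
  then have "J \<noteq> {}" "\<And>j. j \<in> J \<Longrightarrow> v j = 0" by (auto simp: left_span_def)
  then show ?case using division_subring_1[OF K] by (intro exI[of _ "\<lambda>_. 1"]) auto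
next
  case (insert b B)
  note cl = division_subring_closed[OF K]
  have "\<exists>d. (\<forall>x\<in>insert b B. d x \<in> K) \<and> v j = (\<Sum>x\<in>insert b B. d x * x)" if "j \<in> J" for j
    using insert.prems(3)[OF that] by (auto simp: left_span_def)
  then have "\<forall>j\<in>J. \<exists>a\<in>K. \<exists>u\<in>left_span K B. v j = a * b + u"
    using insert.hyps by (fastforce intro: left_spanI)
  then obtain a where a: "\<And>j. j \<in> J \<Longrightarrow> a j \<in> K" "\<And>j. j \<in> J \<Longrightarrow> v j - a j * b \<in> left_span K B"
    by (metis add_diff_cancel_left')
  show ?case
  proof (cases "\<forall>j\<in>J. a j = 0")
    case True
    then show ?thesis using insert.IH[of J v] insert.prems insert.hyps a by auto
  next
    case False
    then obtain p where p: "p \<in> J" "a p \<noteq> 0" by blast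
    define v' where "v' j = v j - a j * inverse (a p) * v p" for j
    have "v' j \<in> left_span K B" if "j \<in> J - {p}" for j
    proof -
      have "inverse (a p) * (a p * b) = b" using p by (simp flip: mult.assoc)
      then have "v' j = (v j - a j * b) - a j * inverse (a p) * (v p - a p * b)"
        using p by (simp add: v'_def right_diff_distrib mult.assoc)
      moreover have "a j * inverse (a p) \<in> K" using that p a by (simp add: cl)
      ultimately show ?thesis using that p a(2)
        by (simp add: left_span_diff[OF K] left_span_scale[OF K])
    qed
    moreover have "card B < card (J - {p})" using insert p by simp
    ultimately obtain c where c: "\<forall>j\<in>J - {p}. c j \<in> K" "\<exists>j\<in>J - {p}. c j \<noteq> 0"
      "(\<Sum>j\<in>J - {p}. c j * v' j) = 0"
      using insert.IH[of "J - {p}" v'] insert.prems by blast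
    \<comment> \<open>The coefficient of \<open>v p\<close> collects the multiples subtracted in the
      \<open>v' j\<close>.\<close>
    define s where "s = (\<Sum>j\<in>J - {p}. c j * (a j * inverse (a p)))"
    define c' where "c' j = (if j = p then - s else c j)" for j
    have "s \<in> K" unfolding s_def using a c p by (auto intro!: cl)
    then have "\<forall>j\<in>J. c' j \<in> K" using c by (auto simp: c'_def intro: cl)
    moreover have "\<exists>j\<in>J. c' j \<noteq> 0" using c(2) by (auto simp: c'_def)
    moreover have "(\<Sum>j\<in>J. c' j * v j) = 0"
    proof -
      have "(\<Sum>j\<in>J. c' j * v j) = (\<Sum>j\<in>J - {p}. c j * v j) - s * v p"
        using p insert.prems(1) by (simp add: sum.remove[of J p] c'_def)
      also have "\<dots> = (\<Sum>j\<in>J - {p}. c j * v' j)"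
        by (simp add: v'_def s_def right_diff_distrib sum_subtractf sum_distrib_right mult.assoc)
      finally show ?thesis using c by simp
    qed
    ultimately show ?thesis by blast
  qed
qed

text \<open>A linear relation between the powers of \<open>x\<close>, divided by its lowest term, expresses \<open>inverse x\<close>.\<close>

lemma division_subring_left_span:
  assumes K: "division_subring K" and B: "finite B" and "1 \<in> left_span K B"
    and mult: "\<And>x y. x \<in> left_span K B \<Longrightarrow> y \<in> left_span K B \<Longrightarrow> x * y \<in> left_span K B"
  shows "division_subring (left_span K B)"
proof (rule division_subringI, goal_cases)
  case (4 x)
  note cl = division_subring_closed[OF K]
  have pw: "x ^ j \<in> left_span K B" for j
    by (induction j) (auto intro: assms(3) mult 4)
  obtain c where c: "\<forall>j\<in>{..card B}. c j \<in> K" "\<exists>j\<in>{..card B}. c j \<noteq> 0"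
    "(\<Sum>j\<in>{..card B}. c j * x ^ j) = 0"
    using left_dependent[OF K B, of "{..card B}" "\<lambda>j. x ^ j"] pw by auto
  define i where "i = (LEAST j. c j \<noteq> 0)"
  obtain j0 where j0: "j0 \<le> card B" "c j0 \<noteq> 0" using c(2) by auto
  have i: "c i \<noteq> 0" "\<And>j. j < i \<Longrightarrow> c j = 0" "i \<le> card B"
    using LeastI[of "\<lambda>j. c j \<noteq> 0", OF j0(2)] Least_le[of "\<lambda>j. c j \<noteq> 0", OF j0(2)] j0(1)
    unfolding i_def by (auto dest: not_less_Least)
  \<comment> \<open>The exponents leave out one factor \<open>x\<close>, which the relation then
    shows on the right of the sum; so \<open>y\<close> is a left inverse of
    \<open>x\<close>.\<close>
  define y where "y = - (inverse (c i) * (\<Sum>j\<in>{i<..card B}. c j * x ^ (j - i - 1)))"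
  have "0 = (\<Sum>j\<in>{i..card B}. c j * x ^ j)"
  proof -
    have "(\<Sum>j\<in>{..card B}. c j * x ^ j) = (\<Sum>j\<in>{i..card B}. c j * x ^ j)"
      by (rule sum.mono_neutral_right) (auto simp: i)
    then show ?thesis using c by simp
  qed
  also have "\<dots> = c i * x ^ i + (\<Sum>j\<in>{i<..card B}. c j * x ^ j)"
    using i by (simp add: sum.head)
  also have "\<dots> = (c i + (\<Sum>j\<in>{i<..card B}. c j * x ^ (j - i - 1)) * x) * x ^ i"
  proof -
    have "x ^ j = x ^ (j - i - 1) * x * x ^ i" if "j \<in> {i<..card B}" for j
    proof -
      have "j = (j - i - 1) + 1 + i" using that by simp
      then show ?thesis by (metis power_add power_one_right)
    qed
    then show ?thesis
      by (simp add: distrib_right sum_distrib_right mult.assoc)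
  qed
  finally have *: "c i + (\<Sum>j\<in>{i<..card B}. c j * x ^ (j - i - 1)) * x = 0" using 4 by simp
  have "y * x = - (inverse (c i) * ((\<Sum>j\<in>{i<..card B}. c j * x ^ (j - i - 1)) * x))"
    by (simp add: y_def mult.assoc)
  also have "(\<Sum>j\<in>{i<..card B}. c j * x ^ (j - i - 1)) * x = - c i"
    using * by (simp add: eq_neg_iff_add_eq_0 add.commute)
  finally have "y * x = 1" using i by simp
  then have "inverse x = y" using inverse_unique[of y x] by auto
  moreover have "y \<in> left_span K B"
  proof -
    have "(\<Sum>j\<in>{i<..card B}. c j * x ^ (j - i - 1)) \<in> left_span K B"
      using c pw by (auto intro!: left_span_sum left_span_scale K)
    then have "inverse (c i) * (\<Sum>j\<in>{i<..card B}. c j * x ^ (j - i - 1)) \<in> left_span K B"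
      using c i by (auto intro!: left_span_scale K cl)
    from left_span_diff[OF K left_span_0[OF K] this] show ?thesis by (simp add: y_def)
  qed
  ultimately show ?case by simp
qed (auto intro: assms left_span_diff)

section \<open>Subrings of a central extension\<close>

text \<open>The induction removes a term whenever a coefficient does not commute with \<open>H\<close>,
  by solving the commutator relation for the corresponding \<open>c i\<close>.\<close>

lemma centralizing_sum_in_centralizing_part:
  fixes H K :: "'a::division_ring set" and h c :: "'i \<Rightarrow> 'a"
  assumes H: "division_subring H" and K: "division_subring K"
    and comm: "\<And>x y. x \<in> H \<Longrightarrow> y \<in> K \<Longrightarrow> x * y = y * x"
    and centre: "\<And>x. x \<in> H \<Longrightarrow> (\<forall>y\<in>H. y * x = x * y) \<Longrightarrow> x \<in> K"
    and "finite I" "\<And>i. i \<in> I \<Longrightarrow> h i \<in> H" "\<And>i. i \<in> I \<Longrightarrow> c i \<in> K"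
    and "\<And>y. y \<in> H \<Longrightarrow> y * (\<Sum>i\<in>I. h i * c i) = (\<Sum>i\<in>I. h i * c i) * y"
  shows "(\<Sum>i\<in>I. h i * c i) \<in> K"
  using assms(5-)
proof (induction I arbitrary: h rule: finite_psubset_induct)
  case (psubset I)
  note clH = division_subring_closed[OF H] and clK = division_subring_closed[OF K]
  show ?case
  proof (cases "\<forall>i\<in>I. \<forall>y\<in>H. y * h i = h i * y")
    case True
    then show ?thesis using psubset.prems centre by (auto intro!: clK)
  next
    case False
    then obtain p y where p: "p \<in> I" "y \<in> H" "y * h p \<noteq> h p * y" by blast
    define d where "d i = y * h i - h i * y" for i
    have dH: "d i \<in> H" if "i \<in> I" for i using that p psubset.prems by (auto simp: d_def intro!: clH)
    have dp: "d p \<noteq> 0" using p by (simp add: d_def)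
    have "d i * c i = y * (h i * c i) - (h i * c i) * y" if "i \<in> I" for i
      using comm[OF p(2) psubset.prems(2)[OF that]] by (simp add: d_def left_diff_distrib mult.assoc)
    then have "(\<Sum>i\<in>I. d i * c i) = y * (\<Sum>i\<in>I. h i * c i) - (\<Sum>i\<in>I. h i * c i) * y"
      by (simp add: sum_subtractf sum_distrib_left sum_distrib_right)
    also have "\<dots> = 0" using psubset.prems(3)[OF p(2)] by simp
    finally have "d p * c p + (\<Sum>i\<in>I - {p}. d i * c i) = 0"
      using p psubset.hyps(1) by (simp add: sum.remove)
    then have "d p * c p = - (\<Sum>i\<in>I - {p}. d i * c i)" by (simp add: eq_neg_iff_add_eq_0)
    then have "inverse (d p) * (d p * c p) = inverse (d p) * - (\<Sum>i\<in>I - {p}. d i * c i)" by simp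
    then have cp: "c p = - (inverse (d p) * (\<Sum>i\<in>I - {p}. d i * c i))"
      using dp by (simp flip: mult.assoc)
    define h' where "h' i = h i - h p * inverse (d p) * d i" for i
    have eq: "(\<Sum>i\<in>I. h i * c i) = (\<Sum>i\<in>I - {p}. h' i * c i)"
    proof -
      have "(\<Sum>i\<in>I. h i * c i) = (\<Sum>i\<in>I - {p}. h i * c i) + h p * c p"
        using p psubset.hyps(1) by (simp add: sum.remove add.commute)
      also have "\<dots> = (\<Sum>i\<in>I - {p}. h' i * c i)"
        by (simp add: cp h'_def left_diff_distrib sum_subtractf sum_distrib_left mult.assoc)
      finally show ?thesis .
    qed
    show ?thesis unfolding eq
    proof (rule psubset.IH)
      show "I - {p} \<subset> I" using p by blast
      show "h' i \<in> H" if "i \<in> I - {p}" for i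
        using that p psubset.prems dH by (auto simp: h'_def intro!: clH)
      show "c i \<in> K" if "i \<in> I - {p}" for i using that psubset.prems by simp
      show "z * (\<Sum>i\<in>I - {p}. h' i * c i) = (\<Sum>i\<in>I - {p}. h' i * c i) * z" if "z \<in> H" for z
        using psubset.prems(3)[OF that] unfolding eq .
    qed
  qed
qed

text \<open>Take a sum with as few terms as possible and make one coefficient \<open>1\<close>; its commutators
  with \<open>H\<close> are shorter, so they lie in \<open>N\<close>, and a nonzero one would shorten the sum.\<close>

lemma subring_generated_by_centralizer:
  fixes H N L :: "'a::division_ring set" and w n :: "'i \<Rightarrow> 'a"
  assumes N: "division_subring N" and L: "division_subring L" and HN: "H \<subseteq> N" and NL: "N \<subseteq> L"
    and cent: "\<And>x. x \<in> L \<Longrightarrow> (\<forall>y\<in>H. y * x = x * y) \<Longrightarrow> x \<in> N"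
    and "finite I" and w: "\<And>i y. i \<in> I \<Longrightarrow> y \<in> H \<Longrightarrow> y * w i = w i * y"
    and "\<And>i. i \<in> I \<Longrightarrow> n i \<in> N" and "(\<Sum>i\<in>I. n i * w i) \<in> L"
  shows "(\<Sum>i\<in>I. n i * w i) \<in> N"
  using assms(6-)
proof (induction I arbitrary: n rule: finite_psubset_induct)
  case (psubset I)
  note clN = division_subring_closed[OF N] and clL = division_subring_closed[OF L]
  show ?case
  \<comment> \<open>If a nontrivial combination lies in \<open>N\<close>, a left multiple of it
    cancels the term \<open>p\<close> and a shorter sum remains.\<close>
  proof (cases "\<exists>m. (\<forall>i\<in>I. m i \<in> N) \<and> (\<exists>i\<in>I. m i \<noteq> 0) \<and> (\<Sum>i\<in>I. m i * w i) \<in> N")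
    case True
    then obtain m p where m: "\<And>i. i \<in> I \<Longrightarrow> m i \<in> N" "p \<in> I" "m p \<noteq> 0" "(\<Sum>i\<in>I. m i * w i) \<in> N"
      by blast
    define q where "q = n p * inverse (m p)"
    define s where "s = (\<Sum>i\<in>I. m i * w i)"
    have qN: "q \<in> N" using m psubset.prems by (auto simp: q_def intro!: clN)
    then have qsN: "q * s \<in> N" using m by (auto simp: s_def intro!: clN)
    have "(\<Sum>i\<in>I. n i * w i) - q * s = (\<Sum>i\<in>I. (n i - q * m i) * w i)"
      by (simp add: s_def left_diff_distrib sum_subtractf sum_distrib_left mult.assoc)
    also have "\<dots> = (\<Sum>i\<in>I - {p}. (n i - q * m i) * w i)"
      using m psubset.hyps(1) by (simp add: sum.remove[of I p] q_def mult.assoc)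
    finally have eq: "(\<Sum>i\<in>I. n i * w i) - q * s = (\<Sum>i\<in>I - {p}. (n i - q * m i) * w i)" .
    have "(\<Sum>i\<in>I - {p}. (n i - q * m i) * w i) \<in> N"
    proof (rule psubset.IH)
      show "I - {p} \<subset> I" using m by blast
      show "n i - q * m i \<in> N" if "i \<in> I - {p}" for i
        using that m psubset.prems qN by (auto intro!: clN)
      show "(\<Sum>i\<in>I - {p}. (n i - q * m i) * w i) \<in> L"
        unfolding eq[symmetric] using psubset.prems qsN NL by (blast intro: clL(3))
    qed (use psubset.prems in auto)
    from clN(7)[OF this qsN] show ?thesis unfolding eq[symmetric] by simp
  next
    case indep: False
    show ?thesis
    proof (cases "\<exists>p\<in>I. n p \<noteq> 0")
      case False
      then show ?thesis by (auto intro: clN)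
    next
      case True
      then obtain p where p: "p \<in> I" "n p \<noteq> 0" by blast
      define n' where "n' i = inverse (n p) * n i" for i
      define z where "z = (\<Sum>i\<in>I. n' i * w i)"
      have n'N: "n' i \<in> N" if "i \<in> I" for i
        using that p psubset.prems by (auto simp: n'_def intro!: clN)
      have z: "z = inverse (n p) * (\<Sum>i\<in>I. n i * w i)"
        by (simp add: z_def n'_def sum_distrib_left mult.assoc)
      have zL: "z \<in> L" unfolding z using p psubset.prems NL by (auto intro!: clL)
      have comm: "y * n' i = n' i * y" if y: "y \<in> H" and i: "i \<in> I" for y i
      proof -
        define d where "d i = y * n' i - n' i * y" for i
        have dN: "d i \<in> N" if "i \<in> I" for i
          using that n'N y HN by (auto simp: d_def intro!: clN)
        have "d p = 0" using p by (simp add: d_def n'_def)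
        have "d i * w i = y * (n' i * w i) - (n' i * w i) * y" if "i \<in> I" for i
          using psubset.prems(1)[OF that y] by (simp add: d_def left_diff_distrib mult.assoc)
        then have c: "(\<Sum>i\<in>I. d i * w i) = y * z - z * y"
          by (simp add: z_def sum_subtractf sum_distrib_left sum_distrib_right)
        have r: "(\<Sum>i\<in>I. d i * w i) = (\<Sum>i\<in>I - {p}. d i * w i)"
          using p psubset.hyps(1) \<open>d p = 0\<close> by (simp add: sum.remove)
        have "(\<Sum>i\<in>I - {p}. d i * w i) \<in> N"
        proof (rule psubset.IH)
          show "I - {p} \<subset> I" using p by blast
          show "(\<Sum>i\<in>I - {p}. d i * w i) \<in> L"
            unfolding r[symmetric] c using zL y HN NL by (auto intro!: clL)
        qed (use psubset.prems dN in auto)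
        then have "(\<Sum>i\<in>I. d i * w i) \<in> N" using r by simp
        then have "d i = 0" using indep dN i by blast
        then show ?thesis by (simp add: d_def)
      qed
      \<comment> \<open>Now all coefficients of \<open>z\<close> centralize \<open>H\<close>, as the
        \<open>w i\<close> do, so \<open>cent\<close> applies to \<open>z\<close>.\<close>
      have "y * z = z * y" if "y \<in> H" for y
      proof -
        have "y * (n' i * w i) = (n' i * w i) * y" if i: "i \<in> I" for i
          using comm[OF \<open>y \<in> H\<close> i] psubset.prems(1)[OF i \<open>y \<in> H\<close>] by (metis mult.assoc)
        then show ?thesis by (simp add: z_def sum_distrib_left sum_distrib_right)
      qed
      then have "z \<in> N" using cent zL by blast
      moreover have "(\<Sum>i\<in>I. n i * w i) = n p * z" using p by (simp add: z flip: mult.assoc)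
      ultimately show ?thesis using p psubset.prems by (auto intro!: clN)
    qed
  qed
qed

text \<open>Commutators with \<open>H\<close> lower the degree of a monic relation, so a relation of least degree
  has centralizing coefficients.\<close>

lemma centralizing_relation:
  fixes H N :: "'a::division_ring set" and e :: 'a
  assumes N: "division_subring N" and HN: "H \<subseteq> N"
    and e: "\<And>y. y \<in> H \<Longrightarrow> y * e = e * y"
    and alg: "algebraic_over N e"
  shows "\<exists>r c. (\<forall>j<r. c j \<in> N \<and> (\<forall>y\<in>H. y * c j = c j * y)) \<and> e ^ r + (\<Sum>j<r. c j * e ^ j) = 0"
proof -
  note cl = division_subring_closed[OF N]
  obtain B where b: "finite_left_basis N (adjoin N {e}) B"
    using alg unfolding algebraic_over_def finite_left_dim_def by (elim exE)
  have "left_span N B = {v. \<exists>c. (\<forall>b\<in>B. c b \<in> N) \<and> v = (\<Sum>b\<in>B. c b * b)}"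
    unfolding left_span_def by (intro Collect_cong ex_cong1 conj_commute)
  then have B: "finite B" "adjoin N {e} = left_span N B"
    using b unfolding finite_left_basis_def by simp_all
  have "e ^ j \<in> left_span N B" for j
    unfolding B(2)[symmetric] using adjoin_gen[of "{e}" N]
    by (auto intro: division_subring_power[OF division_subring_adjoin])
  with left_dependent[OF N B(1), of "{..card B}" "\<lambda>j. e ^ j"]
  obtain c where c: "\<forall>j\<in>{..card B}. c j \<in> N" "\<exists>j\<in>{..card B}. c j \<noteq> 0"
    "(\<Sum>j\<in>{..card B}. c j * e ^ j) = 0" by auto
  define P where "P r \<longleftrightarrow> (\<exists>c. (\<forall>j\<le>r. c j \<in> N) \<and> c r \<noteq> 0 \<and> (\<Sum>j\<le>r. c j * e ^ j) = 0)" for r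
  have top: "\<exists>r\<le>m. P r" if "\<forall>j\<le>m. c j \<in> N" "\<exists>j\<le>m. c j \<noteq> 0" "(\<Sum>j\<le>m. c j * e ^ j) = 0" for m c
    using that
  proof (induction m)
    case 0
    then show ?case by (auto simp: P_def intro!: exI[of _ c])
  next
    case (Suc m)
    show ?case
    proof (cases "c (Suc m) = 0")
      case True
      then have "\<exists>j\<le>m. c j \<noteq> 0" using Suc.prems by (metis le_Suc_eq)
      then show ?thesis using Suc True by (auto intro: le_SucI)
    next
      case False
      then show ?thesis using Suc.prems by (auto simp: P_def intro!: exI[of _ "Suc m"] exI[of _ c])
    qed
  qed
  have "\<exists>r. P r" using top[of "card B" c] c by auto
  then obtain r where r: "P r" "\<And>r'. P r' \<Longrightarrow> r \<le> r'"
    using LeastI_ex[of P] Least_le[of P] by blast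
  obtain a where a: "\<forall>j\<le>r. a j \<in> N" "a r \<noteq> 0" "(\<Sum>j\<le>r. a j * e ^ j) = 0"
    using r(1) by (auto simp: P_def)
  define b where "b j = inverse (a r) * a j" for j
  have bN: "b j \<in> N" if "j \<le> r" for j using that a by (auto simp: b_def intro!: cl)
  have "(\<Sum>j\<le>r. b j * e ^ j) = inverse (a r) * (\<Sum>j\<le>r. a j * e ^ j)"
    by (simp add: b_def sum_distrib_left mult.assoc)
  then have b0: "(\<Sum>j\<le>r. b j * e ^ j) = 0" using a by simp
  have br: "b r = 1" using a by (simp add: b_def)
  have "y * b j = b j * y" if y: "y \<in> H" and j: "j < r" for y j
  proof (rule ccontr)
    assume ne: "y * b j \<noteq> b j * y"
    define d where "d i = y * b i - b i * y" for i
    have ye: "y * e ^ i = e ^ i * y" for i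
      by (induction i) (simp_all, metis e[OF y] mult.assoc)
    have "d i * e ^ i = y * (b i * e ^ i) - (b i * e ^ i) * y" for i
      using ye[of i] by (simp add: d_def left_diff_distrib mult.assoc)
    then have "(\<Sum>i\<le>r. d i * e ^ i) = y * (\<Sum>i\<le>r. b i * e ^ i) - (\<Sum>i\<le>r. b i * e ^ i) * y"
      by (simp add: sum_subtractf sum_distrib_left sum_distrib_right)
    then have "(\<Sum>i\<le>r. d i * e ^ i) = 0" using b0 by simp
    moreover have "d r = 0" by (simp add: d_def br)
    \<comment> \<open>From \<open>j < r\<close> follows \<open>r > 0\<close>, so
      \<open>r - 1\<close> is a genuine predecessor.\<close>
    moreover have "{..r} = insert r {..r - 1}" "r \<notin> {..r - 1}" using j by auto
    ultimately have "(\<Sum>i\<le>r - 1. d i * e ^ i) = 0" by simp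
    moreover have "\<forall>i\<le>r - 1. d i \<in> N" using bN y HN by (auto simp: d_def intro!: cl)
    moreover have "\<exists>i\<le>r - 1. d i \<noteq> 0" using ne j by (intro exI[of _ j]) (auto simp: d_def)
    ultimately obtain r' where "r' \<le> r - 1" "P r'" using top by blast
    then show False using r(2)[of r'] j by simp
  qed
  moreover have "e ^ r + (\<Sum>j<r. b j * e ^ j) = 0"
    using b0 br by (simp add: lessThan_Suc_atMost[symmetric] add.commute)
  ultimately show ?thesis using bN by (intro exI[of _ r] exI[of _ b]) auto
qed

text \<open>The span is the compositum of \<open>H\<close> and \<open>K\<close>: coefficients from
  \<open>K\<close> move past \<open>B\<close>, products of elements of \<open>B\<close> fall back
  into \<open>H\<close>, and finiteness of \<open>B\<close> supplies the inverses.\<close>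

lemma division_subring_central_extension:
  fixes H K B :: "'a::division_ring set"
  assumes K: "division_subring K" and B: "finite B" "B \<subseteq> H" and H: "H \<subseteq> left_span K B"
    and comm: "\<And>x y. x \<in> H \<Longrightarrow> y \<in> K \<Longrightarrow> x * y = y * x"
    and HH: "1 \<in> H" "\<And>x y. x \<in> H \<Longrightarrow> y \<in> H \<Longrightarrow> x * y \<in> H"
  shows "division_subring (left_span K B)" "K \<subseteq> left_span K B"
proof -
  show "K \<subseteq> left_span K B"
  proof
    fix x assume "x \<in> K"
    then have "x * 1 \<in> left_span K B" using H HH(1) by (blast intro: left_span_scale[OF K])
    then show "x \<in> left_span K B" by simp
  qed
  show "division_subring (left_span K B)"
  proof (rule division_subring_left_span[OF K B(1)])
    show "1 \<in> left_span K B" using H HH by blast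
    fix x y assume "x \<in> left_span K B" "y \<in> left_span K B"
    then obtain c d where cd: "\<forall>b\<in>B. c b \<in> K" "x = (\<Sum>b\<in>B. c b * b)"
      "\<forall>b\<in>B. d b \<in> K" "y = (\<Sum>b\<in>B. d b * b)" by (auto simp: left_span_def)
    have "c b * b * (d b' * b') = c b * (d b' * (b * b'))" if "b \<in> B" "b' \<in> B" for b b'
    proof -
      have "b * d b' = d b' * b" using comm that B cd by blast
      then show ?thesis by (metis mult.assoc)
    qed
    moreover have "b * b' \<in> left_span K B" if "b \<in> B" "b' \<in> B" for b b'
      using that B HH(2) H by blast
    ultimately have "c b * b * (d b' * b') \<in> left_span K B" if "b \<in> B" "b' \<in> B" for b b'
      using that cd by (simp add: left_span_scale[OF K])
    then show "x * y \<in> left_span K B"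
      by (auto simp: cd sum_product intro!: left_span_sum[OF K])
  qed
qed

section \<open>Substitution into polynomials\<close>

locale unital_ring_hom =
  fixes h :: "'a::ring_1 \<Rightarrow> 'b::ring_1"
  assumes one: "h 1 = 1" and add: "h (x + y) = h x + h y" and mult: "h (x * y) = h x * h y"
begin

lemma zero: "h 0 = 0"
  using add[of 0 0] by simp

lemma diff: "h (x - y) = h x - h y"
  using add[of "x - y" y] by (simp add: algebra_simps)

lemma sum: "h (sum f A) = (\<Sum>x\<in>A. h (f x))"
  by (induction A rule: infinite_finite_induct) (simp_all add: zero add)

lemma power: "h (x ^ n) = h x ^ n"
  by (induction n) (simp_all add: one mult)

end

lemma sum_singles: "p = (\<Sum>m\<in>Poly_Mapping.keys p. Poly_Mapping.single m (Poly_Mapping.lookup p m))"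
  by (rule poly_mapping_eqI)
    (simp add: lookup_sum lookup_single when_def sum.delta in_keys_iff)

text \<open>Given on monomials instead of variables, so that one construction covers Kronecker's
  substitution, the shift, the specialization \<open>t = 0\<close> and the embedding into the
  fraction ring.\<close>

definition subst_monoms ::
    "('c::zero \<Rightarrow> 's::ring_1) \<Rightarrow> ('m \<Rightarrow> 's) \<Rightarrow> ('m \<Rightarrow>\<^sub>0 'c) \<Rightarrow> 's" where
  "subst_monoms c M p = (\<Sum>m\<in>Poly_Mapping.keys p. c (Poly_Mapping.lookup p m) * M m)"

locale monom_subst = c: unital_ring_hom c
  for c :: "'c::ring_1 \<Rightarrow> 's::ring_1" +
  fixes M :: "'m::comm_monoid_add \<Rightarrow> 's"
  assumes M_0: "M 0 = 1" and M_add: "M (m + n) = M m * M n"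
    and commute: "c a * M m = M m * c a"
begin

lemma superset:
  assumes "finite A" "Poly_Mapping.keys p \<subseteq> A"
  shows "subst_monoms c M p = (\<Sum>m\<in>A. c (Poly_Mapping.lookup p m) * M m)"
  unfolding subst_monoms_def using assms
  by (intro sum.mono_neutral_left) (auto simp: c.zero in_keys_iff)

lemma single: "subst_monoms c M (Poly_Mapping.single m a) = c a * M m"
  by (simp add: subst_monoms_def c.zero)

lemma add: "subst_monoms c M (p + q) = subst_monoms c M p + subst_monoms c M q"
proof -
  let ?A = "Poly_Mapping.keys p \<union> Poly_Mapping.keys q"
  have "Poly_Mapping.keys (p + q) \<subseteq> ?A" by (rule keys_add)
  then show ?thesis
    by (simp add: superset[of ?A] lookup_add c.add distrib_right sum.distrib)
qed

lemma sum: "subst_monoms c M (sum f A) = (\<Sum>x\<in>A. subst_monoms c M (f x))"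
  by (induction A rule: infinite_finite_induct) (simp_all add: add, simp_all add: subst_monoms_def)

lemma mult: "subst_monoms c M (p * q) = subst_monoms c M p * subst_monoms c M q"
proof -
  let ?s = "\<lambda>p m. Poly_Mapping.single m (Poly_Mapping.lookup p m)"
  have "p * q = (\<Sum>m\<in>Poly_Mapping.keys p. ?s p m) * (\<Sum>n\<in>Poly_Mapping.keys q. ?s q n)"
    by (simp flip: sum_singles)
  also have "\<dots> = (\<Sum>m\<in>Poly_Mapping.keys p. \<Sum>n\<in>Poly_Mapping.keys q.
      Poly_Mapping.single (m + n) (Poly_Mapping.lookup p m * Poly_Mapping.lookup q n))"
    by (simp add: sum_product mult_single)
  finally have "subst_monoms c M (p * q) = (\<Sum>m\<in>Poly_Mapping.keys p. \<Sum>n\<in>Poly_Mapping.keys q.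
      c (Poly_Mapping.lookup p m) * c (Poly_Mapping.lookup q n) * (M m * M n))"
    by (simp add: sum single c.mult M_add)
  also have "\<dots> = subst_monoms c M p * subst_monoms c M q"
  proof -
    have "c a * c b * (M m * M n) = (c a * M m) * (c b * M n)" for a b m n
      using commute[of b m] by (metis mult.assoc)
    then show ?thesis by (simp add: subst_monoms_def sum_product)
  qed
  finally show ?thesis .
qed

lemma unital_ring_hom_subst: "unital_ring_hom (subst_monoms c M)"
  using single[of 0 1] by (unfold_locales) (simp_all add: add mult c.one M_0)

end

lemma (in unital_ring_hom) subst_monoms_comp:
  "h (subst_monoms c M p) = subst_monoms (\<lambda>a. h (c a)) (\<lambda>m. h (M m)) p"
  by (simp add: subst_monoms_def sum mult)

lemma unital_ring_hom_single_0: "unital_ring_hom (\<lambda>a. Poly_Mapping.single (0::'m::comm_monoid_add) a)"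
  by unfold_locales (simp_all add: single_add mult_single)

lemma unital_ring_hom_pCons_0: "unital_ring_hom (\<lambda>a::'a::comm_ring_1. [:a:])"
  by unfold_locales simp_all

lemma unital_ring_hom_comp:
  "unital_ring_hom f \<Longrightarrow> unital_ring_hom g \<Longrightarrow> unital_ring_hom (\<lambda>x. g (f x))"
  by (simp add: unital_ring_hom_def)

subsection \<open>Kronecker substitution\<close>

definition weight :: "('n::finite \<Rightarrow> nat) \<Rightarrow> ('n \<Rightarrow>\<^sub>0 nat) \<Rightarrow> nat" where
  "weight w m = (\<Sum>i\<in>UNIV. w i * Poly_Mapping.lookup m i)"

lemma weight_add: "weight w (m + n) = weight w m + weight w n"
  by (simp add: weight_def lookup_add distrib_left sum.distrib)

text \<open>Uniqueness of expansions in base \<open>b\<close>: the digit of index \<open>0\<close>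
  is the remainder modulo \<open>b\<close>, and the rest follows by induction.\<close>

lemma digits_eq:
  fixes f g :: "nat \<Rightarrow> nat"
  assumes "\<forall>j<n. f j < b" "\<forall>j<n. g j < b" "(\<Sum>j<n. b ^ j * f j) = (\<Sum>j<n. b ^ j * g j)"
  shows "\<forall>j<n. f j = g j"
  using assms
proof (induction n arbitrary: f g)
  case (Suc n)
  have split: "(\<Sum>j<Suc n. b ^ j * h j) = h 0 + b * (\<Sum>j<n. b ^ j * h (Suc j))" for h
    by (simp add: sum.lessThan_Suc_shift sum_distrib_left mult.assoc del: sum.lessThan_Suc)
  have eq: "f 0 + b * (\<Sum>j<n. b ^ j * f (Suc j)) = g 0 + b * (\<Sum>j<n. b ^ j * g (Suc j))"
    using Suc.prems(3) by (simp only: split)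
  have lt: "f 0 < b" "g 0 < b" using Suc.prems by auto
  have "f 0 = (f 0 + b * (\<Sum>j<n. b ^ j * f (Suc j))) mod b" using lt by simp
  also have "\<dots> = g 0" unfolding eq using lt by simp
  finally have 0: "f 0 = g 0" .
  then have "(\<Sum>j<n. b ^ j * f (Suc j)) = (\<Sum>j<n. b ^ j * g (Suc j))" using eq lt by simp
  then have "\<forall>j<n. f (Suc j) = g (Suc j)" using Suc.prems by (intro Suc.IH) auto
  then show ?case using 0 by (auto simp: less_Suc_eq_0_disj)
qed simp

text \<open>The weights are powers of a base above all exponents in \<open>A\<close>, so
  \<open>weight w\<close> reads an exponent vector as the digits of a number.\<close>

lemma separating_weight:
  fixes A :: "('n::finite \<Rightarrow>\<^sub>0 nat) set"
  assumes "finite A"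
  shows "\<exists>w. (\<forall>i. 0 < w i) \<and> inj_on (weight w) A"
proof -
  obtain e :: "nat \<Rightarrow> 'n" where e: "bij_betw e {..<CARD('n)} UNIV"
    using ex_bij_betw_nat_finite[of "UNIV :: 'n set"] by (auto simp: atLeast0LessThan)
  \<comment> \<open>The sum is a crude bound for all exponents; \<open>Suc\<close> makes it strict
    and keeps the weights positive.\<close>
  define b where "b = Suc (\<Sum>m\<in>A. \<Sum>i\<in>UNIV. Poly_Mapping.lookup m i)"
  have b: "Poly_Mapping.lookup m i < b" if "m \<in> A" for m i
  proof -
    have "Poly_Mapping.lookup m i \<le> (\<Sum>i\<in>UNIV. Poly_Mapping.lookup m i)"
      by (rule member_le_sum) auto
    also have "\<dots> \<le> (\<Sum>m\<in>A. \<Sum>i\<in>UNIV. Poly_Mapping.lookup m i)"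
      using that assms by (intro member_le_sum) auto
    finally show ?thesis by (simp add: b_def)
  qed
  define w where "w i = b ^ the_inv_into {..<CARD('n)} e i" for i
  have we: "w (e j) = b ^ j" if "j < CARD('n)" for j
    using that e by (simp add: w_def the_inv_into_f_f bij_betw_def)
  have wt: "weight w m = (\<Sum>j<CARD('n). b ^ j * Poly_Mapping.lookup m (e j))" for m
    unfolding weight_def sum.reindex_bij_betw[OF e, symmetric] by (simp add: we)
  have "inj_on (weight w) A"
  proof (rule inj_onI)
    fix m n assume mn: "m \<in> A" "n \<in> A" "weight w m = weight w n"
    have "\<forall>j<CARD('n). Poly_Mapping.lookup m (e j) = Poly_Mapping.lookup n (e j)"
      using mn b by (intro digits_eq[where b = b]) (simp_all add: wt)
    moreover have "\<exists>j<CARD('n). i = e j" for i using e by (auto simp: bij_betw_def)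
    ultimately show "m = n" by (intro poly_mapping_eqI) metis
  qed
  moreover have "0 < w i" for i by (simp add: w_def b_def)
  ultimately show ?thesis by blast
qed

definition kronecker :: "('n::finite \<Rightarrow> nat) \<Rightarrow> ('n, 'k::comm_ring_1) mpoly \<Rightarrow> 'k poly" where
  "kronecker w = subst_monoms (\<lambda>a. [:a:]) (\<lambda>m. monom 1 (weight w m))"

lemma monom_subst_kronecker:
  "monom_subst (\<lambda>a::'k::comm_ring_1. [:a:]) (\<lambda>m. monom 1 (weight w m))"
  by (intro monom_subst.intro monom_subst_axioms.intro unital_ring_hom_pCons_0)
    (simp_all add: weight_add mult_monom monom_0 one_pCons weight_def[of _ 0] mult.commute)

lemma unital_ring_hom_kronecker: "unital_ring_hom (kronecker w)"
  unfolding kronecker_def by (rule monom_subst.unital_ring_hom_subst[OF monom_subst_kronecker])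

lemma kronecker_single_0: "kronecker w (Poly_Mapping.single 0 a) = [:a:]"
  unfolding kronecker_def monom_subst.single[OF monom_subst_kronecker]
  by (simp add: weight_def monom_0)

text \<open>Distinct monomials of \<open>p\<close> go to distinct powers of \<open>t\<close>, so
  nothing cancels. The hypothesis concerns the support of \<open>p\<close> only, as the substitution
  need not be injective.\<close>

lemma kronecker_eq_0:
  assumes "inj_on (weight w) (Poly_Mapping.keys p)" "kronecker w p = 0"
  shows "p = 0"
proof (rule ccontr)
  assume "p \<noteq> 0"
  then obtain m where m: "m \<in> Poly_Mapping.keys p" by (metis keys_eq_empty all_not_in_conv)
  have "coeff (kronecker w p) (weight w m) = (\<Sum>n\<in>Poly_Mapping.keys p.
      if weight w n = weight w m then Poly_Mapping.lookup p n else 0)"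
    by (auto simp: kronecker_def subst_monoms_def coeff_sum intro!: sum.cong)
  also have "\<dots> = (\<Sum>n\<in>Poly_Mapping.keys p. if n = m then Poly_Mapping.lookup p n else 0)"
    using assms(1) m by (intro sum.cong) (auto dest: inj_onD)
  also have "\<dots> = Poly_Mapping.lookup p m" using m by simp
  finally show False using m assms(2) by (simp add: in_keys_iff)
qed

subsection \<open>Shifted variables\<close>

text \<open>The order compares exponents at the first index where they differ, and no entry lies
  below \<open>0\<close>.\<close>

lemma poly_mapping_nat_ge_0: "(0 :: nat \<Rightarrow>\<^sub>0 nat) \<le> m"
proof (rule ccontr)
  assume "\<not> 0 \<le> m"
  then have "m < 0" by simp
  then have "less_fun (Poly_Mapping.lookup m) (Poly_Mapping.lookup 0)"
    by (simp add: less_poly_mapping.rep_eq)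
  then show False by (auto elim: less_funE)
qed

lemma unital_ring_hom_lookup_0:
  "unital_ring_hom (\<lambda>p :: (nat \<Rightarrow>\<^sub>0 nat) \<Rightarrow>\<^sub>0 'c::comm_ring_1. Poly_Mapping.lookup p 0)"
proof unfold_locales
  fix p q :: "(nat \<Rightarrow>\<^sub>0 nat) \<Rightarrow>\<^sub>0 'c"
  have "keys_above 0 s" for s :: "(nat \<Rightarrow>\<^sub>0 nat) \<Rightarrow>\<^sub>0 'c"
    by (simp add: keys_above_def poly_mapping_nat_ge_0)
  from keys_above_mult(2)[OF this this]
  show "Poly_Mapping.lookup (p * q) 0 = Poly_Mapping.lookup p 0 * Poly_Mapping.lookup q 0"
    by fastforce
qed (simp_all add: lookup_add)

definition power_product :: "('n::finite \<Rightarrow> 's::comm_ring_1) \<Rightarrow> ('n \<Rightarrow>\<^sub>0 nat) \<Rightarrow> 's" where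
  "power_product x m = (\<Prod>i\<in>UNIV. x i ^ Poly_Mapping.lookup m i)"

lemma monom_subst_power_product:
  fixes x :: "'n::finite \<Rightarrow> 's::comm_ring_1"
  assumes "unital_ring_hom c"
  shows "monom_subst c (power_product x)"
  using assms by (intro monom_subst.intro monom_subst_axioms.intro)
    (simp_all add: power_product_def lookup_add power_add prod.distrib mult.commute)

lemma unital_ring_hom_power_product:
  fixes h :: "'a::comm_ring_1 \<Rightarrow> 'b::comm_ring_1" and x :: "'n::finite \<Rightarrow> 'a"
  assumes "unital_ring_hom h"
  shows "h (power_product x m) = power_product (\<lambda>i. h (x i)) m"
proof -
  interpret unital_ring_hom h by fact
  have "h (prod f A) = (\<Prod>x\<in>A. h (f x))" for f :: "'n \<Rightarrow> 'a" and A
    by (induction A rule: infinite_finite_induct) (simp_all add: one mult)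
  then show ?thesis by (simp add: power_product_def power)
qed

lemma power_product_monom:
  fixes w :: "'n::finite \<Rightarrow> nat"
  shows "power_product (\<lambda>i. monom (1::'k::comm_ring_1) (w i)) m = monom 1 (weight w m)"
proof -
  have "(\<Prod>i\<in>A. monom (1::'k) (f i)) = monom 1 (sum f A)" for f :: "'n \<Rightarrow> nat" and A
    by (induction A rule: infinite_finite_induct) (simp_all add: mult_monom monom_0 one_pCons)
  then show ?thesis by (simp add: power_product_def monom_power weight_def)
qed

text \<open>\<open>T_i\<close> goes to \<open>t ^ w i + s_(e i)\<close>, with \<open>t\<close> the
  inner and the \<open>s\<close> the outer variables. The \<open>s\<close> are numbered through
  \<open>e\<close> because the place needs linearly ordered exponents and \<open>'n\<close> carries
  no order.\<close>

definition shift ::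
    "('n::finite \<Rightarrow> nat) \<Rightarrow> ('n \<Rightarrow> nat) \<Rightarrow> ('n, 'k::comm_ring_1) mpoly \<Rightarrow> (nat \<Rightarrow>\<^sub>0 nat) \<Rightarrow>\<^sub>0 'k poly" where
  "shift w e = subst_monoms (\<lambda>a. Poly_Mapping.single 0 [:a:])
     (power_product (\<lambda>i. Poly_Mapping.single 0 (monom 1 (w i))
        + Poly_Mapping.single (Poly_Mapping.single (e i) 1) 1))"

lemma monom_subst_shift:
  "monom_subst (\<lambda>a::'k::comm_ring_1. Poly_Mapping.single 0 [:a:])
     (power_product (\<lambda>i::'n::finite. Poly_Mapping.single (0 :: nat \<Rightarrow>\<^sub>0 nat) (monom 1 (w i))
        + Poly_Mapping.single (Poly_Mapping.single (e i) 1) 1))"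
  by (intro monom_subst_power_product unital_ring_hom_comp[OF unital_ring_hom_pCons_0]
      unital_ring_hom_single_0)

lemma unital_ring_hom_shift: "unital_ring_hom (shift w e)"
  unfolding shift_def by (rule monom_subst.unital_ring_hom_subst[OF monom_subst_shift])

lemma shift_single_0: "shift w e (Poly_Mapping.single 0 a) = Poly_Mapping.single 0 [:a:]"
  unfolding shift_def monom_subst.single[OF monom_subst_shift] by (simp add: power_product_def)

text \<open>This computes the place on shifted fractions whose denominator survives at
  \<open>s = 0\<close>, in particular on the image of \<open>g\<close>.\<close>

lemma lookup_shift_0: "Poly_Mapping.lookup (shift w e p) 0 = kronecker w p"
proof -
  have "(Poly_Mapping.single (e i) (1::nat)) \<noteq> 0" for i
    by (metis lookup_single_eq lookup_zero one_neq_zero)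
  then show ?thesis
    unfolding shift_def kronecker_def
      unital_ring_hom.subst_monoms_comp[OF unital_ring_hom_lookup_0]
      unital_ring_hom_power_product[OF unital_ring_hom_lookup_0]
    by (simp add: lookup_add lookup_single_not_eq power_product_monom)
qed

text \<open>At \<open>t = 0\<close> the shift by \<open>t ^ w i\<close> disappears.\<close>

lemma shift_eq_0:
  fixes p :: "('n::finite, 'k::comm_ring_1) mpoly"
  assumes w: "\<And>i. 0 < w i" and e: "inj e" and p: "shift w e p = 0"
  shows "p = 0"
proof -
  let ?M = "\<lambda>m :: nat \<Rightarrow>\<^sub>0 nat. Poly_Mapping.single m (1::'k)"
  let ?c = "\<lambda>c :: 'k poly. Poly_Mapping.single (0 :: nat \<Rightarrow>\<^sub>0 nat) (coeff c 0)"
  \<comment> \<open>\<open>h\<close> sets \<open>t = 0\<close> and keeps the variables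
    \<open>s\<close>; as \<open>w i > 0\<close>, it leaves only the variable \<open>s_(e i)\<close>
    of the image of \<open>T_i\<close>. Below, \<tau> renames exponents along
    \<open>e\<close>.\<close>
  define h where "h = subst_monoms ?c ?M"
  define \<tau> :: "('n \<Rightarrow>\<^sub>0 nat) \<Rightarrow> nat \<Rightarrow>\<^sub>0 nat"
    where "\<tau> m = (\<Sum>i\<in>UNIV. Poly_Mapping.single (e i) (Poly_Mapping.lookup m i))" for m
  have "unital_ring_hom (\<lambda>c::'k poly. coeff c 0)"
    by unfold_locales (simp_all add: coeff_mult_0)
  from unital_ring_hom_comp[OF this unital_ring_hom_single_0]
  have ms: "monom_subst ?c ?M"
    by (intro monom_subst.intro monom_subst_axioms.intro) (simp_all add: mult_single)
  have hom: "unital_ring_hom h"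
    unfolding h_def by (rule monom_subst.unital_ring_hom_subst[OF ms])
  have hs: "h (Poly_Mapping.single m a) = Poly_Mapping.single m (coeff a 0)" for m a
    unfolding h_def monom_subst.single[OF ms] by (simp add: mult_single)
  have pp: "power_product (\<lambda>i. ?M (Poly_Mapping.single (e i) 1)) m = ?M (\<tau> m)" for m
  proof -
    have "?M n ^ k = ?M (of_nat k * n)" for n k
      by (induction k) (simp_all add: mult_single distrib_right)
    moreover have "of_nat k * Poly_Mapping.single (e i) (1::nat) = Poly_Mapping.single (e i) k" for i k
      by (induction k) (simp_all add: distrib_right flip: single_add)
    moreover have "(\<Prod>i\<in>A. ?M (f i)) = ?M (sum f A)" for f and A :: "'n set"
      by (induction A rule: infinite_finite_induct) (simp_all add: mult_single)
    ultimately show ?thesis by (simp add: power_product_def \<tau>_def)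
  qed
  have "coeff (monom (1::'k) (w i)) 0 = 0" for i using w[of i] by simp
  then have hx: "h (Poly_Mapping.single 0 (monom 1 (w i))
      + Poly_Mapping.single (Poly_Mapping.single (e i) 1) 1) = ?M (Poly_Mapping.single (e i) 1)" for i
    by (simp add: unital_ring_hom.add[OF hom] hs)
  have "h (shift w e p) = subst_monoms (Poly_Mapping.single 0) (\<lambda>m. ?M (\<tau> m)) p"
    unfolding shift_def unital_ring_hom.subst_monoms_comp[OF hom]
      unital_ring_hom_power_product[OF hom] hx pp by (simp add: hs)
  then have z: "subst_monoms (Poly_Mapping.single 0) (\<lambda>m. ?M (\<tau> m)) p = 0"
    using p unital_ring_hom.zero[OF hom] by simp
  have "Poly_Mapping.lookup (\<tau> m) (e i) = Poly_Mapping.lookup m i" for m i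
  proof -
    have "Poly_Mapping.lookup (\<tau> m) (e i)
        = (\<Sum>j\<in>UNIV. if j = i then Poly_Mapping.lookup m j else 0)"
      using e by (auto simp: \<tau>_def lookup_sum lookup_single when_def inj_eq intro!: sum.cong)
    then show ?thesis by simp
  qed
  then have \<tau>: "\<tau> m = \<tau> n \<longleftrightarrow> m = n" for m n by (metis poly_mapping_eqI)
  have "Poly_Mapping.lookup p m = 0" for m
  proof -
    have "0 = Poly_Mapping.lookup (subst_monoms (Poly_Mapping.single 0) (\<lambda>m. ?M (\<tau> m)) p) (\<tau> m)"
      by (simp add: z)
    also have "\<dots> = (\<Sum>n\<in>Poly_Mapping.keys p. if n = m then Poly_Mapping.lookup p n else 0)"
      by (auto simp: subst_monoms_def lookup_sum mult_single lookup_single when_def \<tau>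
          intro!: sum.cong)
    also have "\<dots> = Poly_Mapping.lookup p m" by (simp add: in_keys_iff)
    finally show ?thesis by simp
  qed
  then show ?thesis by (intro poly_mapping_eqI) simp
qed

section \<open>The centre of a division ring as a field\<close>

lemma ring_center_iff: "z \<in> ring_center \<longleftrightarrow> (\<forall>x. z * x = x * z)"
  by (simp add: ring_center_def)

lemma division_subring_ring_center: "division_subring (ring_center :: 'a::division_ring set)"
proof -
  have "(ring_center :: 'a set) = {z. \<forall>h\<in>UNIV. h * z = z * h}"
    by (auto simp: ring_center_def)
  then show ?thesis using division_subring_centralizer[of "UNIV :: 'a set"] by simp
qed

text \<open>The centre becomes a type because \<open>Lueroth\<close> speaks of polynomials over a
  field type.\<close>

typedef (overloaded) ('a::division_ring) center = "ring_center :: 'a set"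
  morphisms of_center to_center
  using division_subring_1[OF division_subring_ring_center] by blast

instantiation center :: (division_ring) field
begin

definition "0 = to_center 0"
definition "1 = to_center 1"
definition "x + y = to_center (of_center x + of_center y)"
definition "x - y = to_center (of_center x - of_center y)"
definition "- x = to_center (- of_center x)"
definition "x * y = to_center (of_center x * of_center y)"
definition "inverse x = to_center (inverse (of_center x))"
definition "x div y = to_center (of_center x / of_center y)" for x y :: "'a center"

lemma of_center_simps [simp]:
  "of_center (0 :: 'a center) = 0"
  "of_center (1 :: 'a center) = 1"
  "of_center (x + y :: 'a center) = of_center x + of_center y"
  "of_center (x - y :: 'a center) = of_center x - of_center y"
  "of_center (- x :: 'a center) = - of_center x"
  "of_center (x * y :: 'a center) = of_center x * of_center y"
  "of_center (inverse x :: 'a center) = inverse (of_center x)"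
  "of_center (x div y :: 'a center) = of_center x / of_center y"
  using of_center[of x] of_center[of y] division_subring_closed[OF division_subring_ring_center[where 'a = 'a]]
  by (simp_all add: zero_center_def one_center_def plus_center_def minus_center_def
      uminus_center_def times_center_def inverse_center_def divide_center_def to_center_inverse)

instance
proof
  show "a * b = b * a" for a b :: "'a center"
    using of_center[of a] by (simp add: ring_center_iff flip: of_center_inject)
qed (simp_all add: algebra_simps divide_inverse flip: of_center_inject)

end

text \<open>Every field is Euclidean in a trivial way; this leads to the class
  \<open>field_gcd\<close> that \<open>Lueroth\<close> requires.\<close>

instantiation center ::
  (division_ring) "{unique_euclidean_ring, normalization_euclidean_semiring, normalization_semidom_multiplicative}"
begin

definition [simp]: "normalize_center = (normalize_field :: 'a center \<Rightarrow> _)"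
definition [simp]: "unit_factor_center = (unit_factor_field :: 'a center \<Rightarrow> _)"
definition [simp]: "modulo_center = (mod_field :: 'a center \<Rightarrow> _)"
definition [simp]: "euclidean_size_center = (euclidean_size_field :: 'a center \<Rightarrow> _)"
definition [simp]: "division_segment (x :: 'a center) = 1"

instance
  by standard (simp_all add: dvd_field_iff field_split_simps split: if_splits)

end

instantiation center :: (division_ring) euclidean_ring_gcd
begin

definition gcd_center :: "'a center \<Rightarrow> 'a center \<Rightarrow> 'a center" where
  "gcd_center = Euclidean_Algorithm.gcd"
definition lcm_center :: "'a center \<Rightarrow> 'a center \<Rightarrow> 'a center" where
  "lcm_center = Euclidean_Algorithm.lcm"
definition Gcd_center :: "'a center set \<Rightarrow> 'a center" where
  "Gcd_center = Euclidean_Algorithm.Gcd"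
definition Lcm_center :: "'a center set \<Rightarrow> 'a center" where
  "Lcm_center = Euclidean_Algorithm.Lcm"

instance
  by standard (simp_all add: gcd_center_def lcm_center_def Gcd_center_def Lcm_center_def)

end

instance center :: (division_ring) field_gcd ..

section \<open>Commuting fractions\<close>

locale commuting_fractions = unital_ring_hom \<eta>
  for \<eta> :: "'p::comm_ring_1 \<Rightarrow> 'd::division_ring" +
  assumes inj0: "\<eta> a = 0 \<Longrightarrow> a = 0"
begin

text \<open>An equation without inverses, so that computing with fractions in the noncommutative
  \<open>'d\<close> only permutes images of \<eta>, which commute.\<close>

definition fracs :: "'d set" where
  "fracs = {x. \<exists>a b. b \<noteq> 0 \<and> x * \<eta> b = \<eta> a}"

lemma commute: "\<eta> a * \<eta> b = \<eta> b * \<eta> a"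
  by (metis mult mult.commute)

lemma inj: "\<eta> a = \<eta> b \<Longrightarrow> a = b"
  using inj0[of "a - b"] by (simp add: diff)

text \<open>\<open>'p\<close> is only a commutative ring; the absence of zero divisors is inherited
  from the division ring.\<close>

lemma mult_nonzero: "b \<noteq> 0 \<Longrightarrow> d \<noteq> 0 \<Longrightarrow> b * d \<noteq> 0" for b d :: 'p
  using inj0[of b] inj0[of d] mult[of b d] zero by auto

lemma frac_iff:
  assumes "b \<noteq> 0"
  shows "x * \<eta> b = \<eta> a \<longleftrightarrow> x = \<eta> a * inverse (\<eta> b)"
proof -
  have nz: "\<eta> b \<noteq> 0" using inj0 assms by blast
  show ?thesis
  proof
    assume "x * \<eta> b = \<eta> a"
    then have "\<eta> a * inverse (\<eta> b) = x * (\<eta> b * inverse (\<eta> b))" by (simp add: mult.assoc[symmetric])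
    then show "x = \<eta> a * inverse (\<eta> b)" using nz by simp
  next
    assume "x = \<eta> a * inverse (\<eta> b)"
    then show "x * \<eta> b = \<eta> a" using nz by (simp add: mult.assoc)
  qed
qed

lemma fracI: "b \<noteq> 0 \<Longrightarrow> x * \<eta> b = \<eta> a \<Longrightarrow> x \<in> fracs"
  by (auto simp: fracs_def)

lemma frac_diff:
  assumes "x * \<eta> b = \<eta> a" "y * \<eta> d = \<eta> c"
  shows "(x - y) * \<eta> (b * d) = \<eta> (a * d - c * b)"
proof -
  have "(x - y) * \<eta> (b * d) = x * \<eta> b * \<eta> d - y * \<eta> d * \<eta> b"
    by (simp add: mult left_diff_distrib mult.assoc commute[of b d])
  then show ?thesis by (simp add: assms diff mult)
qed

lemma frac_mult:
  assumes "x * \<eta> b = \<eta> a" "y * \<eta> d = \<eta> c"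
  shows "(x * y) * \<eta> (b * d) = \<eta> (a * c)"
proof -
  have "(x * y) * \<eta> (b * d) = x * (y * \<eta> d * \<eta> b)"
    by (simp add: mult mult.assoc commute[of b d])
  also have "\<dots> = x * \<eta> b * \<eta> c" by (simp add: assms(2) mult.assoc commute[of c b])
  finally show ?thesis by (simp add: assms mult)
qed

text \<open>Any two representations of an element satisfy the cross relation; this makes
  \<open>frac_map\<close> single-valued.\<close>

lemma frac_unique:
  assumes "x * \<eta> b = \<eta> a" "x * \<eta> d = \<eta> c"
  shows "a * d = c * b"
proof -
  have "\<eta> (a * d) = x * (\<eta> b * \<eta> d)" by (simp add: mult mult.assoc flip: assms)
  also have "\<dots> = \<eta> (c * b)" by (simp add: commute[of b d] mult mult.assoc flip: assms)
  finally show ?thesis by (rule inj)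
qed

lemma eta_in_fracs: "\<eta> a \<in> fracs"
proof (rule fracI)
  show "(1::'p) \<noteq> 0" using one zero by force
qed (simp add: one)

lemma division_subring_fracs: "division_subring fracs"
proof (rule division_subringI, goal_cases)
  case 1
  show ?case using eta_in_fracs[of 1] by (simp add: one)
next
  case (2 x y)
  then show ?case unfolding fracs_def using frac_diff mult_nonzero by blast
next
  case (3 x y)
  then show ?case unfolding fracs_def using frac_mult mult_nonzero by blast
next
  case (4 x)
  then obtain a b where ab: "b \<noteq> 0" "x * \<eta> b = \<eta> a" by (auto simp: fracs_def)
  have "a \<noteq> 0" using ab 4(2) inj0[of b] by (auto simp: zero)
  moreover have "inverse x * \<eta> a = \<eta> b"
    unfolding ab(2)[symmetric] using 4(2) by (simp flip: mult.assoc)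
  ultimately show ?case by (rule fracI)
qed

definition frac_map :: "('p \<Rightarrow> 's::idom) \<Rightarrow> 'd \<Rightarrow> 's fract \<Rightarrow> bool" where
  "frac_map \<sigma> x z \<longleftrightarrow> (\<exists>a b. b \<noteq> 0 \<and> x * \<eta> b = \<eta> a \<and> z = Fract (\<sigma> a) (\<sigma> b))"

lemma frac_mapI: "b \<noteq> 0 \<Longrightarrow> x * \<eta> b = \<eta> a \<Longrightarrow> frac_map \<sigma> x (Fract (\<sigma> a) (\<sigma> b))"
  by (auto simp: frac_map_def)

lemma frac_map_dom: "x \<in> fracs \<Longrightarrow> \<exists>z. frac_map \<sigma> x z"
  by (auto simp: fracs_def frac_map_def)

lemma partial_hom_frac_map:
  fixes \<sigma> :: "'p \<Rightarrow> 's::idom"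
  assumes "unital_ring_hom \<sigma>" and \<sigma>0: "\<And>a. \<sigma> a = 0 \<Longrightarrow> a = 0"
  shows "partial_hom (frac_map \<sigma>)"
proof -
  interpret \<sigma>: unital_ring_hom \<sigma> by fact
  show ?thesis
  proof (unfold_locales, goal_cases)
    case (1 x y z)
    obtain a b where ab: "b \<noteq> 0" "x * \<eta> b = \<eta> a" "y = Fract (\<sigma> a) (\<sigma> b)"
      using 1(1) by (auto simp: frac_map_def)
    obtain c d where cd: "d \<noteq> 0" "x * \<eta> d = \<eta> c" "z = Fract (\<sigma> c) (\<sigma> d)"
      using 1(2) by (auto simp: frac_map_def)
    have "\<sigma> a * \<sigma> d = \<sigma> c * \<sigma> b"
      using frac_unique[OF ab(2) cd(2)] by (metis \<sigma>.mult)
    moreover have "\<sigma> b \<noteq> 0" "\<sigma> d \<noteq> 0" using ab cd \<sigma>0 by auto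
    ultimately show ?case using ab cd by (simp add: eq_fract)
  next
    case 2
    have "(1::'p) \<noteq> 0" using one zero by force
    from frac_mapI[OF this, of 1 1 \<sigma>] show ?case by (simp add: \<sigma>.one One_fract_def)
  next
    case (3 x y x' y')
    obtain a b where ab: "b \<noteq> 0" "x * \<eta> b = \<eta> a" "y = Fract (\<sigma> a) (\<sigma> b)"
      using 3(1) by (auto simp: frac_map_def)
    obtain c d where cd: "d \<noteq> 0" "x' * \<eta> d = \<eta> c" "y' = Fract (\<sigma> c) (\<sigma> d)"
      using 3(2) by (auto simp: frac_map_def)
    have "\<sigma> b \<noteq> 0" "\<sigma> d \<noteq> 0" using ab cd \<sigma>0 by auto
    then show ?case
      using frac_mapI[OF mult_nonzero[OF ab(1) cd(1)] frac_diff[OF ab(2) cd(2)], of \<sigma>] ab cd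
      by (simp add: \<sigma>.diff \<sigma>.mult diff_fract)
  next
    case (4 x y x' y')
    obtain a b where ab: "b \<noteq> 0" "x * \<eta> b = \<eta> a" "y = Fract (\<sigma> a) (\<sigma> b)"
      using 4(1) by (auto simp: frac_map_def)
    obtain c d where cd: "d \<noteq> 0" "x' * \<eta> d = \<eta> c" "y' = Fract (\<sigma> c) (\<sigma> d)"
      using 4(2) by (auto simp: frac_map_def)
    then show ?case
      using frac_mapI[OF mult_nonzero[OF ab(1) cd(1)] frac_mult[OF ab(2) cd(2)], of \<sigma>] ab cd
      by (simp add: \<sigma>.mult)
  qed
qed

end

text \<open>A homomorphism defined on all of \<open>E\<close> is injective there, so
  \<open>E\<close> is isomorphic to its image in \<open>k(t)\<close> and a generator of the image
  pulls back.\<close>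

lemma Lueroth_pullback:
  fixes \<rho> :: "'d::division_ring \<Rightarrow> 'k::field_gcd poly fract \<Rightarrow> bool"
  assumes "partial_hom \<rho>" and E: "division_subring E" and dom: "\<And>x. x \<in> E \<Longrightarrow> \<exists>y. \<rho> x y"
    and c: "\<And>a. \<rho> (c a) (to_fract [:a:])" and cE: "range c \<subseteq> E"
    and g: "g \<in> E" "\<rho> g \<gamma>" "\<gamma> \<notin> fract_consts"
  shows "\<exists>f \<in> E - range c. E \<subseteq> adjoin (range c) {f}"
proof -
  interpret partial_hom \<rho> by fact
  define E' where "E' = {y. \<exists>x\<in>E. \<rho> x y}"
  have "division_subring E'" unfolding E'_def by (rule division_subring_image[OF E dom])
  moreover have "fract_consts \<subseteq> E'" using c cE by (auto simp: E'_def)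
  moreover have "\<not> E' \<subseteq> fract_consts" using g by (auto simp: E'_def)
  ultimately obtain f' where f': "f' \<in> E' - fract_consts" "E' \<subseteq> adjoin fract_consts {f'}"
    using Lueroth[of E'] by blast
  then obtain f where f: "f \<in> E" "\<rho> f f'" by (auto simp: E'_def)
  \<comment> \<open>\<rho> is only known to be defined on \<open>E\<close>; the intersection keeps
    \<open>M\<close> inside \<open>E\<close> by construction.\<close>
  define M where "M = adjoin (range c) {f} \<inter> E"
  have M: "division_subring M" unfolding M_def
    by (rule division_subring_Int[OF division_subring_adjoin E])
  have "adjoin fract_consts {f'} \<subseteq> {y. \<exists>x\<in>M. \<rho> x y}"
  proof (rule adjoin_least)
    show "division_subring {y. \<exists>x\<in>M. \<rho> x y}"
      by (rule division_subring_image[OF M]) (auto simp: M_def intro: dom)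
    have "c a \<in> M" for a using adjoin_base[of "range c" "{f}"] cE by (auto simp: M_def)
    then show "fract_consts \<subseteq> {y. \<exists>x\<in>M. \<rho> x y}" using c by auto
    have "f \<in> M" using adjoin_gen[of "{f}" "range c"] f by (auto simp: M_def)
    then show "{f'} \<subseteq> {y. \<exists>x\<in>M. \<rho> x y}" using f by auto
  qed
  then have *: "E' \<subseteq> {y. \<exists>x\<in>M. \<rho> x y}" using f' by blast
  have "E \<subseteq> adjoin (range c) {f}"
  proof
    fix e assume e: "e \<in> E"
    then obtain y where y: "\<rho> e y" using dom by blast
    then have "y \<in> E'" using e by (auto simp: E'_def)
    then obtain x where x: "x \<in> M" "\<rho> x y" using * by blast
    then have "x = e" using inj_on_division_subring[OF E dom _ e x(2) y] by (simp add: M_def)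
    then show "e \<in> adjoin (range c) {f}" using x by (simp add: M_def)
  qed
  moreover have "f \<notin> range c"
  proof
    assume "f \<in> range c"
    then obtain a where "f = c a" by blast
    then have "f' = to_fract [:a:]" using f c functional by blast
    then show False using f' by blast
  qed
  ultimately show ?thesis using f by blast
qed

section \<open>Division rings between the coefficients and the fractions\<close>

locale fraction_ring_extension =
  fixes \<iota> :: "('n::finite, 'h::division_ring) mpoly \<Rightarrow> 'd::division_ring"
  assumes fin: "finite_left_dim (ring_center :: 'h set) UNIV"
    and rf: "right_fraction_ring \<iota>"
begin

sublocale \<iota>: unital_ring_hom \<iota>
  using rf by unfold_locales (auto simp: right_fraction_ring_def)

lemma \<iota>_inj: "\<iota> p = \<iota> q \<longleftrightarrow> p = q"
  using rf by (auto simp: right_fraction_ring_def inj_eq)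

lemma \<iota>_fraction: "\<exists>a b. b \<noteq> 0 \<and> d = \<iota> a * inverse (\<iota> b)"
  using rf by (auto simp: right_fraction_ring_def)

section \<open>Polynomials and fractions over the centre inside the fraction ring\<close>

definition const :: "'h \<Rightarrow> 'd" where
  "const h = \<iota> (Poly_Mapping.single 0 h)"

definition cst :: "'h center \<Rightarrow> 'd" where
  "cst a = const (of_center a)"

definition mono :: "('n \<Rightarrow>\<^sub>0 nat) \<Rightarrow> 'd" where
  "mono m = \<iota> (Poly_Mapping.single m 1)"

definition \<eta> :: "('n, 'h center) mpoly \<Rightarrow> 'd" where
  "\<eta> = subst_monoms cst mono"

abbreviation H :: "'d set" where
  "H \<equiv> const_image \<iota> UNIV"

sublocale const: unital_ring_hom const
  unfolding const_def by (rule unital_ring_hom_comp[OF unital_ring_hom_single_0 \<iota>.unital_ring_hom_axioms])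

lemma H_eq: "H = range const"
  by (simp add: const_image_def const_def)

lemma const_inj: "const x = const y \<longleftrightarrow> x = y"
  by (metis const_def \<iota>_inj lookup_single_eq)

lemma range_cst: "range cst = const_image \<iota> ring_center"
proof -
  have "range (of_center :: 'h center \<Rightarrow> 'h) = ring_center"
    using type_definition.Rep_range[OF type_definition_center] .
  then show ?thesis unfolding cst_def const_image_def by (simp add: const_def image_image flip: \<open>_ = ring_center\<close>)
qed

lemma const_mono: "const h * mono m = mono m * const h"
  by (simp add: const_def mono_def mult_single flip: \<iota>.mult)

lemma const_cst: "const h * cst a = cst a * const h"
  using of_center[of a] by (simp add: cst_def ring_center_iff flip: const.mult)

lemma monom_subst_\<eta>: "monom_subst cst mono"
proof (intro monom_subst.intro monom_subst_axioms.intro)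
  show "unital_ring_hom cst"
    by unfold_locales (simp_all add: cst_def const.one const.add const.mult)
  show "mono 0 = 1" by (simp add: mono_def \<iota>.one)
  show "mono (m + n) = mono m * mono n" for m n
    by (simp add: mono_def mult_single flip: \<iota>.mult)
  show "cst a * mono m = mono m * cst a" for a m
    by (simp add: cst_def const_mono)
qed

lemma \<iota>_eq_sum: "\<iota> q = (\<Sum>m\<in>Poly_Mapping.keys q. const (Poly_Mapping.lookup q m) * mono m)"
proof -
  have "\<iota> q = (\<Sum>m\<in>Poly_Mapping.keys q. \<iota> (Poly_Mapping.single m (Poly_Mapping.lookup q m)))"
    by (subst sum_singles) (simp add: \<iota>.sum)
  then show ?thesis by (simp add: const_def mono_def mult_single flip: \<iota>.mult)
qed

lemma of_center_eq_0: "of_center a = 0 \<longleftrightarrow> a = 0"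
  by (metis of_center_inject of_center_simps(1))

text \<open>The substitution form of \<eta> gives the ring laws; this form gives injectivity and the
  comparison with \<open>rational_functions\<close>.\<close>

lemma \<eta>_eq: "\<eta> p = \<iota> (Poly_Mapping.map of_center p)"
proof -
  have lk: "Poly_Mapping.lookup (Poly_Mapping.map of_center p) m = of_center (Poly_Mapping.lookup p m)" for m
    by (simp add: Poly_Mapping.map.rep_eq when_def of_center_eq_0)
  then have "Poly_Mapping.keys (Poly_Mapping.map of_center p) = Poly_Mapping.keys p"
    by (auto simp: in_keys_iff of_center_eq_0)
  then show ?thesis by (simp add: \<iota>_eq_sum \<eta>_def subst_monoms_def cst_def lk)
qed

sublocale \<eta>: commuting_fractions \<eta>
proof (intro commuting_fractions.intro commuting_fractions_axioms.intro)
  show "unital_ring_hom \<eta>" unfolding \<eta>_def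
    by (rule monom_subst.unital_ring_hom_subst[OF monom_subst_\<eta>])
  fix a assume "\<eta> a = 0"
  then have "Poly_Mapping.map of_center a = 0" by (metis \<eta>_eq \<iota>_inj \<iota>.zero)
  then show "a = 0" by (intro poly_mapping_eqI)
      (auto simp: map_eq_zero_iff of_center_eq_0 in_keys_iff)
qed

abbreviation F :: "'d set" where
  "F \<equiv> rational_functions \<iota> ring_center"

text \<open>Polynomials over \<open>'h\<close> with central coefficients correspond to polynomials
  over the type \<open>center\<close>; this makes the commutative results available for
  \<open>F\<close>.\<close>

lemma F_eq: "F = \<eta>.fracs"
proof -
  note * = \<eta>.frac_iff
  have img: "range (Poly_Mapping.lookup q) \<subseteq> ring_center \<longleftrightarrow> (\<exists>p. q = Poly_Mapping.map of_center p)"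
    for q :: "('n, 'h) mpoly"
  proof safe
    assume q: "range (Poly_Mapping.lookup q) \<subseteq> ring_center"
    have to0: "to_center 0 = (0 :: 'h center)" by (simp add: zero_center_def)
    have "q = Poly_Mapping.map of_center (Poly_Mapping.map to_center q)"
    proof (rule poly_mapping_eqI)
      fix m
      have "of_center (to_center (Poly_Mapping.lookup q m)) = Poly_Mapping.lookup q m"
        using q by (intro to_center_inverse) blast
      then show "Poly_Mapping.lookup q m
          = Poly_Mapping.lookup (Poly_Mapping.map of_center (Poly_Mapping.map to_center q)) m"
        by (cases "to_center (Poly_Mapping.lookup q m) = 0")
          (auto simp: Poly_Mapping.map.rep_eq when_def to0)
    qed
    then show "\<exists>p. q = Poly_Mapping.map of_center p" by blast
  next
    fix p m
    show "Poly_Mapping.lookup (Poly_Mapping.map of_center p) m \<in> ring_center"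
      using of_center division_subring_0[OF division_subring_ring_center]
      by (auto simp: Poly_Mapping.map.rep_eq when_def)
  qed
  have nz: "Poly_Mapping.map of_center b \<noteq> 0 \<longleftrightarrow> b \<noteq> 0" for b :: "('n, 'h center) mpoly"
    using \<eta>.inj0[of b] \<eta>.zero by (metis \<eta>_eq \<iota>.zero \<iota>_inj)
  show ?thesis
  proof (intro equalityI subsetI)
    fix x assume "x \<in> F"
    then obtain a b where ab: "b \<noteq> 0" "x = \<iota> (Poly_Mapping.map of_center a) * inverse (\<iota> (Poly_Mapping.map of_center b))"
      unfolding rational_functions_def img using nz by blast
    then have "x * \<eta> b = \<eta> a" unfolding *[OF ab(1)] by (simp add: \<eta>_eq)
    then show "x \<in> \<eta>.fracs" by (rule \<eta>.fracI[OF ab(1)])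
  next
    fix x assume "x \<in> \<eta>.fracs"
    then obtain a b where "b \<noteq> 0" "x = \<eta> a * inverse (\<eta> b)"
      unfolding \<eta>.fracs_def using * by blast
    then show "x \<in> F" unfolding rational_functions_def img \<eta>_eq using nz by blast
  qed
qed

lemma cst_eq_\<eta>: "cst a = \<eta> (Poly_Mapping.single 0 a)"
  unfolding \<eta>_def monom_subst.single[OF monom_subst_\<eta>] monom_subst.M_0[OF monom_subst_\<eta>] by simp

lemma division_subring_F: "division_subring F"
  by (simp add: F_eq \<eta>.division_subring_fracs)

lemma cst_in_F: "range cst \<subseteq> F"
  by (auto simp: F_eq cst_eq_\<eta> \<eta>.eta_in_fracs)

lemma mono_in_F: "mono m \<in> F"
proof -
  have "\<eta> (Poly_Mapping.single m 1) = mono m"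
    unfolding \<eta>_def monom_subst.single[OF monom_subst_\<eta>] by (simp add: cst_def const.one)
  then show ?thesis using \<eta>.eta_in_fracs F_eq by metis
qed

text \<open>The centralizer of \<open>H\<close> is a division subring containing the central
  constants and the monomials, hence all fractions built from them.\<close>

lemma H_F_commute:
  assumes "x \<in> H" "y \<in> F"
  shows "x * y = y * x"
proof -
  obtain h where h: "x = const h" using assms by (auto simp: H_eq)
  let ?C = "{z. \<forall>x\<in>H. x * z = z * x}"
  have C: "division_subring ?C" by (rule division_subring_centralizer)
  have \<eta>C: "\<eta> p \<in> ?C" for p
    unfolding \<eta>_def subst_monoms_def using const_cst const_mono
    by (intro division_subring_sum[OF C] division_subring_mult[OF C]) (auto simp: H_eq)
  obtain a b where "b \<noteq> 0" "y * \<eta> b = \<eta> a" using assms(2) by (auto simp: F_eq \<eta>.fracs_def)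
  then have "y = \<eta> a * inverse (\<eta> b)"
    using \<eta>.frac_iff by blast
  then have "y \<in> ?C"
    using \<eta>C division_subring_mult[OF C] division_subring_inverse[OF C] by presburger
  then show ?thesis using assms(1) by blast
qed

lemma division_subring_H: "division_subring H"
proof (rule division_subringI, goal_cases)
  case (4 x)
  then obtain h where h: "x = const h" by (auto simp: H_eq)
  then have "h \<noteq> 0" using 4 const.zero by auto
  then have "x * const (inverse h) = 1" by (simp add: h const.one flip: const.mult)
  from inverse_unique[OF this] show ?case by (simp add: H_eq)
next
  case 1
  show ?case using const.one H_eq by (metis rangeI)
qed (auto simp: H_eq simp flip: const.diff const.mult)

section \<open>Centralizers of \<open>H\<close> and intermediate division rings\<close>

lemma center_of_H:
  assumes "x \<in> H" "\<forall>y\<in>H. y * x = x * y"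
  shows "x \<in> range cst"
proof -
  obtain h where h: "x = const h" using assms by (auto simp: H_eq)
  then have "y * h = h * y" for y
    using assms(2) by (auto simp: H_eq const_inj simp flip: const.mult)
  then have "h \<in> ring_center" by (auto simp: ring_center_def)
  then have "x = cst (to_center h)" by (simp add: h cst_def to_center_inverse)
  then show ?thesis by blast
qed

text \<open>Coordinates over the centre lie in every such \<open>K\<close>, so one finite set spans
  \<open>H\<close> over all of them at once.\<close>

lemma ex_basis:
  "\<exists>B. finite B \<and> B \<subseteq> H \<and> (\<forall>K. division_subring K \<longrightarrow> range cst \<subseteq> K \<longrightarrow> H \<subseteq> left_span K B)"
proof -
  obtain B where "finite_left_basis (ring_center :: 'h set) UNIV B"
    using fin unfolding finite_left_dim_def by blast
  then have B: "finite B" "UNIV = {v. \<exists>c. (\<forall>b\<in>B. c b \<in> ring_center) \<and> v = (\<Sum>b\<in>B. c b * b)}"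
    unfolding finite_left_basis_def by blast+
  have "H \<subseteq> left_span K (const ` B)" if K: "division_subring K" "range cst \<subseteq> K" for K
  proof
    fix x assume "x \<in> H"
    then obtain h where h: "x = const h" by (auto simp: H_eq)
    obtain c where c: "\<forall>b\<in>B. c b \<in> ring_center" "h = (\<Sum>b\<in>B. c b * b)" using B(2) by blast
    have "const b \<in> left_span K (const ` B)" if "b \<in> B" for b
    proof -
      have "(\<Sum>b'\<in>const ` B. (if b' = const b then 1 else 0) * b') = const b"
        using that B(1) by (simp add: if_distrib[of "\<lambda>x. x * _"] cong: if_cong)
      then show ?thesis
        using left_spanI[of "const ` B" "\<lambda>b'. if b' = const b then 1 else 0" K]
          division_subring_0[OF K(1)] division_subring_1[OF K(1)] by simp
    qed
    moreover have "const (c b) \<in> K" if "b \<in> B" for b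
    proof -
      have "const (c b) = cst (to_center (c b))" using that c by (simp add: cst_def to_center_inverse)
      then show ?thesis using K(2) by blast
    qed
    ultimately show "x \<in> left_span K (const ` B)"
      unfolding h c(2) const.sum const.mult
      by (intro left_span_sum[OF K(1)] left_span_scale[OF K(1)])
  qed
  then show ?thesis using B(1) by (intro exI[of _ "const ` B"]) (auto simp: H_eq)
qed

text \<open>The compositum of \<open>H\<close> and \<open>K\<close> is a finite span, so
  \<open>x\<close> is a sum to which the commutator reduction applies. With \<open>K = F\<close>
  this identifies the centralizer of \<open>H\<close>; with \<open>K = k(g)\<close> it descends the
  coefficients of relations.\<close>

lemma adjoin_centralizer_subset:
  assumes K: "division_subring K" "range cst \<subseteq> K" "K \<subseteq> F"
    and x: "x \<in> adjoin H K" "\<And>y. y \<in> H \<Longrightarrow> y * x = x * y"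
  shows "x \<in> K"
proof -
  obtain B where "finite B" "B \<subseteq> H"
    and "\<forall>K. division_subring K \<longrightarrow> range cst \<subseteq> K \<longrightarrow> H \<subseteq> left_span K B"
    using ex_basis by (elim exE conjE)
  then have B: "finite B" "B \<subseteq> H" "H \<subseteq> left_span K B" using K(1,2) by simp_all
  have comm: "x * y = y * x" if "x \<in> H" "y \<in> K" for x y using that H_F_commute K(3) by blast
  have "1 \<in> H" "\<And>x y. x \<in> H \<Longrightarrow> y \<in> H \<Longrightarrow> x * y \<in> H"
    using division_subring_closed[OF division_subring_H] by auto
  note ext = division_subring_central_extension[OF K(1) B comm this]
  have "adjoin H K \<subseteq> left_span K B"
    using ext B by (intro adjoin_least)
  then obtain c where c: "\<forall>b\<in>B. c b \<in> K" "x = (\<Sum>b\<in>B. c b * b)"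
    using x by (auto simp: left_span_def)
  moreover have "c b * b = b * c b" if "b \<in> B" for b
    using comm[of b "c b"] that c B(2) by auto
  \<comment> \<open>The coefficients commute with \<open>B\<close>; moving them to the right gives
    the form that the commutator lemma expects.\<close>
  ultimately have xe: "x = (\<Sum>b\<in>B. b * c b)" by simp
  show ?thesis unfolding xe
  proof (rule centralizing_sum_in_centralizing_part[OF division_subring_H K(1) comm])
    show "x \<in> K" if "x \<in> H" "\<forall>y\<in>H. y * x = x * y" for x using center_of_H[OF that] K by blast
    show "y * (\<Sum>b\<in>B. b * c b) = (\<Sum>b\<in>B. b * c b) * y" if "y \<in> H" for y
      using x(2)[OF that] xe by simp
  qed (use B c in auto)
qed

lemma adjoin_H_F: "adjoin H F = UNIV"
proof -
  let ?A = "adjoin H F"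
  note cl = division_subring_closed[OF division_subring_adjoin[of H F]]
  have "\<iota> q \<in> ?A" for q
  proof -
    have "const h \<in> ?A" for h using adjoin_base[of H F] by (auto simp: H_eq)
    moreover have "mono m \<in> ?A" for m using adjoin_gen[of F H] mono_in_F by blast
    ultimately have "(\<Sum>m\<in>Poly_Mapping.keys q. const (Poly_Mapping.lookup q m) * mono m) \<in> ?A"
      by (intro division_subring_sum[OF division_subring_adjoin]
          division_subring_mult[OF division_subring_adjoin])
    then show ?thesis by (simp only: \<iota>_eq_sum)
  qed
  then have "\<iota> a * inverse (\<iota> b) \<in> ?A" for a b by (intro cl(4,5))
  then show ?thesis using \<iota>_fraction by (metis UNIV_eq_I)
qed

lemma centralizer_H:
  assumes "\<And>y. y \<in> H \<Longrightarrow> y * x = x * y"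
  shows "x \<in> F"
  using adjoin_centralizer_subset[OF division_subring_F cst_in_F order.refl _ assms] adjoin_H_F
  by blast

text \<open>An element of \<open>L\<close> is a sum over \<open>B\<close> with coordinates in
  \<open>F\<close> that need not lie in \<open>L\<close>. The commutator lemma applies with the
  \<open>b\<close> as coefficients and these coordinates as the centralizing factors.\<close>

lemma intermediate_eq_adjoin:
  assumes L: "division_subring L" "H \<subseteq> L"
  shows "L = adjoin H (L \<inter> F)"
proof
  let ?N = "adjoin H (L \<inter> F)"
  show NL: "?N \<subseteq> L" using L by (intro adjoin_least) auto
  obtain B where "finite B" "B \<subseteq> H"
    and "\<forall>K. division_subring K \<longrightarrow> range cst \<subseteq> K \<longrightarrow> H \<subseteq> left_span K B"
    using ex_basis by (elim exE conjE)
  then have B: "finite B" "B \<subseteq> H" "H \<subseteq> left_span F B"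
    using division_subring_F cst_in_F by simp_all
  have "1 \<in> H" "\<And>x y. x \<in> H \<Longrightarrow> y \<in> H \<Longrightarrow> x * y \<in> H"
    using division_subring_closed[OF division_subring_H] by auto
  note ext = division_subring_central_extension[OF division_subring_F B H_F_commute this]
  have "adjoin H F \<subseteq> left_span F B" using ext B by (intro adjoin_least)
  then have span: "x \<in> left_span F B" for x using adjoin_H_F by blast
  show "L \<subseteq> ?N"
  proof
    fix x assume x: "x \<in> L"
    obtain c where c: "\<forall>b\<in>B. c b \<in> F" "x = (\<Sum>b\<in>B. c b * b)"
      using span[of x] by (auto simp: left_span_def)
    moreover have "c b * b = b * c b" if "b \<in> B" for b
      using H_F_commute[of b "c b"] that c B(2) by auto
    ultimately have xe: "x = (\<Sum>b\<in>B. b * c b)" by simp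
    show "x \<in> ?N" unfolding xe
    proof (rule subring_generated_by_centralizer[OF division_subring_adjoin L(1) adjoin_base NL])
      show "z \<in> ?N" if "z \<in> L" "\<forall>y\<in>H. y * z = z * y" for z
        using centralizer_H[of z] that adjoin_gen[of "L \<inter> F" H] by blast
      show "y * c b = c b * y" if "b \<in> B" "y \<in> H" for b y using that c H_F_commute by blast
      show "b \<in> ?N" if "b \<in> B" for b using that B adjoin_base[of H] by blast
    qed (use B x xe in auto)
  qed
qed

lemma adjoin_cst_subset: "adjoin (range cst) S \<subseteq> adjoin H S"
proof (rule adjoin_least[OF division_subring_adjoin])
  have "range cst \<subseteq> H" by (auto simp: H_eq cst_def)
  then show "range cst \<subseteq> adjoin H S" using adjoin_base[of H S] by blast
qed (rule adjoin_gen)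

lemma simple_if_center_simple:
  assumes L: "division_subring L" "H \<subseteq> L"
    and f: "f \<in> L \<inter> F - range cst" "L \<inter> F \<subseteq> adjoin (range cst) {f}"
  shows "\<exists>f \<in> F - const_image \<iota> ring_center. L = adjoin H {f}"
proof
  show "f \<in> F - const_image \<iota> ring_center" using f by (simp add: range_cst)
  have "adjoin H {f} \<subseteq> L" using L f by (intro adjoin_least) auto
  moreover have "adjoin H (L \<inter> F) \<subseteq> adjoin H {f}"
    using f(2) adjoin_cst_subset[of "{f}"] adjoin_base[of H]
    by (intro adjoin_least division_subring_adjoin) auto
  ultimately show "L = adjoin H {f}" using intermediate_eq_adjoin[OF L] by blast
qed

section \<open>Generators for the commutative part of an intermediate ring\<close>

lemma cst_fraction:
  assumes "unital_ring_hom \<sigma>"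
  shows "\<eta>.frac_map \<sigma> (cst a) (to_fract (\<sigma> (Poly_Mapping.single 0 a)))"
proof -
  have "(1 :: ('n, 'h center) mpoly) \<noteq> 0" by simp
  from \<eta>.frac_mapI[OF this, of "cst a" "Poly_Mapping.single 0 a" \<sigma>] show ?thesis
    by (simp add: \<eta>.one cst_eq_\<eta> unital_ring_hom.one[OF assms] to_fract_def)
qed

text \<open>If the image were the constant \<open>c\<close>, then \<open>a - c b\<close> would be
  sent to \<open>0\<close>. Its support lies in that of \<open>a\<close> and \<open>b\<close>, where
  the weight separates, so \<open>a = c b\<close> and \<open>g\<close> would be constant.\<close>

lemma kronecker_nonconst:
  assumes b: "b \<noteq> 0" "g * \<eta> b = \<eta> a" and g: "g \<notin> range cst"
    and w: "inj_on (weight w) (Poly_Mapping.keys a \<union> Poly_Mapping.keys b)"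
  shows "kronecker w b \<noteq> 0" "Fract (kronecker w a) (kronecker w b) \<notin> fract_consts"
proof -
  interpret k: unital_ring_hom "kronecker w :: ('n, 'h center) mpoly \<Rightarrow> _"
    by (rule unital_ring_hom_kronecker)
  show kb: "kronecker w b \<noteq> 0"
    using kronecker_eq_0[of w b] inj_on_subset[OF w] b(1) by blast
  show "Fract (kronecker w a) (kronecker w b) \<notin> fract_consts"
  proof
    assume "Fract (kronecker w a) (kronecker w b) \<in> fract_consts"
    then obtain c where "Fract (kronecker w a) (kronecker w b) = to_fract [:c:]" by blast
    then have "kronecker w a = [:c:] * kronecker w b"
      using kb by (simp add: to_fract_def eq_fract)
    then have z: "kronecker w (a - Poly_Mapping.single 0 c * b) = 0"
      by (simp only: k.diff k.mult kronecker_single_0 diff_self)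
    have "Poly_Mapping.keys (Poly_Mapping.single 0 c * b) \<subseteq> Poly_Mapping.keys b"
      using keys_mult[of "Poly_Mapping.single 0 c" b] by (auto split: if_splits)
    then have "Poly_Mapping.keys (a - Poly_Mapping.single 0 c * b)
        \<subseteq> Poly_Mapping.keys a \<union> Poly_Mapping.keys b"
      using keys_diff[of a "Poly_Mapping.single 0 c * b"] by blast
    then have "a = Poly_Mapping.single 0 c * b"
      using kronecker_eq_0[OF inj_on_subset[OF w] z] by simp
    then have "g * \<eta> b = cst c * \<eta> b" using b by (simp add: cst_eq_\<eta> \<eta>.mult)
    then have "g = cst c" using \<eta>.inj0[of b] b(1) by auto
    then show False using g by blast
  qed
qed

lemma center_simple_univariate:
  assumes n: "CARD('n) = 1" and E: "division_subring E" "range cst \<subseteq> E" "E \<subseteq> F"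
    and g: "g \<in> E" "g \<notin> range cst"
  shows "\<exists>f \<in> E - range cst. E \<subseteq> adjoin (range cst) {f}"
proof -
  \<comment> \<open>With a single variable, weight \<open>1\<close> separates all exponents, so
    Kronecker's substitution is injective on the whole polynomial ring.\<close>
  define w :: "'n \<Rightarrow> nat" where "w = (\<lambda>_. 1)"
  obtain u :: 'n where u: "UNIV = {u}" using n by (auto simp: card_1_singleton_iff)
  have "inj (weight w)"
  proof (rule injI)
    fix m m' :: "'n \<Rightarrow>\<^sub>0 nat" assume "weight w m = weight w m'"
    then have "Poly_Mapping.lookup m u = Poly_Mapping.lookup m' u" by (simp add: weight_def w_def u)
    then show "m = m'" using u by (intro poly_mapping_eqI) (metis UNIV_I singletonD)
  qed
  then have w: "inj_on (weight w) A" for A by (rule inj_on_subset) simp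
  let ?\<sigma> = "kronecker w :: ('n, 'h center) mpoly \<Rightarrow> _"
  note hom = unital_ring_hom_kronecker[of w]
  obtain a b where ab: "b \<noteq> 0" "g * \<eta> b = \<eta> a" using g E by (auto simp: F_eq \<eta>.fracs_def)
  show ?thesis
  proof (rule Lueroth_pullback[where \<rho> = "\<eta>.frac_map ?\<sigma>"])
    show "partial_hom (\<eta>.frac_map ?\<sigma>)"
      using kronecker_eq_0[OF w] by (rule \<eta>.partial_hom_frac_map[OF hom])
    show "\<exists>y. \<eta>.frac_map ?\<sigma> x y" if "x \<in> E" for x
      using that E(3) F_eq by (intro \<eta>.frac_map_dom) auto
    show "\<eta>.frac_map ?\<sigma> (cst a) (to_fract [:a:])" for a
      using cst_fraction[OF hom] by (simp add: kronecker_single_0)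
    show "\<eta>.frac_map ?\<sigma> g (Fract (?\<sigma> a) (?\<sigma> b))" by (rule \<eta>.frac_mapI[OF ab])
    show "Fract (?\<sigma> a) (?\<sigma> b) \<notin> fract_consts" by (rule kronecker_nonconst[OF ab g(2) w])
  qed (use E g in auto)
qed

lemma center_simple_algebraic:
  assumes E: "division_subring E" "range cst \<subseteq> E" "E \<subseteq> F"
    and g: "g \<in> E" "g \<notin> range cst"
    and int: "\<And>e. e \<in> E \<Longrightarrow>
      \<exists>r c. (\<forall>j<r. c j \<in> adjoin (range cst) {g}) \<and> e ^ r + (\<Sum>j<r. c j * e ^ j) = 0"
  shows "\<exists>f \<in> E - range cst. E \<subseteq> adjoin (range cst) {f}"
proof -
  obtain a b where ab: "b \<noteq> 0" "g * \<eta> b = \<eta> a" using g E by (auto simp: F_eq \<eta>.fracs_def)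
  \<comment> \<open>Separation is asked only for one fraction representing \<open>g\<close>;
    injectivity of the shift rests on the positivity of the weights.\<close>
  obtain w where w: "\<And>i. 0 < w i" "inj_on (weight w) (Poly_Mapping.keys a \<union> Poly_Mapping.keys b)"
    using separating_weight[of "Poly_Mapping.keys a \<union> Poly_Mapping.keys b"] by auto
  obtain e :: "'n \<Rightarrow> nat" where e: "inj e"
    using finite_imp_inj_to_nat_seg[of "UNIV :: 'n set"] by auto
  let ?\<sigma> = "shift w e :: ('n, 'h center) mpoly \<Rightarrow> _"
  let ?\<theta> = "\<eta>.frac_map ?\<sigma>"
  note hom = unital_ring_hom_shift[of w e]
  interpret \<theta>: partial_hom ?\<theta>
    using shift_eq_0[OF w(1) e] by (rule \<eta>.partial_hom_frac_map[OF hom])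
  interpret low: place "low_place :: ((nat \<Rightarrow>\<^sub>0 nat) \<Rightarrow>\<^sub>0 'h center poly) fract \<Rightarrow> _"
    by (rule place_low_place)
  let ?c = "\<lambda>a :: 'h center. to_fract (Poly_Mapping.single (0 :: nat \<Rightarrow>\<^sub>0 nat) [:a:])"
  have \<theta>c: "?\<theta> (cst a) (?c a)" for a
    using cst_fraction[OF hom] by (simp add: shift_single_0)
  have \<theta>_dom: "\<exists>z. ?\<theta> x z" if "x \<in> F" for x using that by (simp add: F_eq \<eta>.frac_map_dom)
  have lowc: "low_place (?c a) (to_fract [:a:])" for a
  proof -
    have "low_place (Fract (Poly_Mapping.single (0 :: nat \<Rightarrow>\<^sub>0 nat) [:a:]) 1)
       (Fract (Poly_Mapping.lookup (Poly_Mapping.single (0 :: nat \<Rightarrow>\<^sub>0 nat) [:a:]) 0)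
         (Poly_Mapping.lookup (1 :: (nat \<Rightarrow>\<^sub>0 nat) \<Rightarrow>\<^sub>0 'h center poly) 0))"
      by (intro low_place_0 poly_mapping_nat_ge_0) simp
    then show ?thesis by (simp add: to_fract_def)
  qed
  define g' where "g' = Fract (?\<sigma> a) (?\<sigma> b)"
  define \<gamma> where "\<gamma> = Fract (kronecker w a) (kronecker w b)"
  note kb = kronecker_nonconst[OF ab g(2) w(2)]
  have \<theta>g: "?\<theta> g g'" unfolding g'_def by (rule \<eta>.frac_mapI[OF ab])
  have lowg: "low_place g' \<gamma>"
    unfolding g'_def \<gamma>_def lookup_shift_0[of w e, symmetric]
    by (intro low_place_0 poly_mapping_nat_ge_0) (simp add: lookup_shift_0 kb)
  interpret s: unital_ring_hom "\<lambda>a :: 'h center. Poly_Mapping.single (0 :: nat \<Rightarrow>\<^sub>0 nat) [:a:]"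
    by (intro unital_ring_hom_comp[OF unital_ring_hom_pCons_0] unital_ring_hom_single_0)
  have ce: "const_embedding ?c"
    by unfold_locales (simp_all only: s.one s.diff s.mult to_fract_1 to_fract_diff to_fract_mult)
  \<comment> \<open>\<open>place_adjoin_dom\<close> works inside a field, while \<open>'d\<close> is
    only a division ring; so \<open>k(g)\<close> is first carried into the field generated by the
    image of \<open>g\<close>.\<close>
  let ?M = "adjoin (range ?c) {g'}"
  have "adjoin (range cst) {g} \<subseteq> {x\<in>F. \<exists>y\<in>?M. ?\<theta> x y}"
  proof (rule adjoin_least)
    show "division_subring {x\<in>F. \<exists>y\<in>?M. ?\<theta> x y}"
      by (rule \<theta>.division_subring_preimage[OF division_subring_F \<theta>_dom division_subring_adjoin])
    show "range cst \<subseteq> {x\<in>F. \<exists>y\<in>?M. ?\<theta> x y}"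
      using cst_in_F \<theta>c adjoin_base[of "range ?c" "{g'}"] by blast
    show "{g} \<subseteq> {x\<in>F. \<exists>y\<in>?M. ?\<theta> x y}"
      using g E(3) \<theta>g adjoin_gen[of "{g'}" "range ?c"] by blast
  qed
  then have coeff: "\<exists>y z. ?\<theta> x y \<and> low_place y z" if "x \<in> adjoin (range cst) {g}" for x
    using that place_adjoin_dom[OF place_low_place ce lowc lowg, of _] kb(2) unfolding \<gamma>_def by blast
  show ?thesis
  proof (rule Lueroth_pullback[where \<rho> = "?\<theta> OO low_place"])
    show "partial_hom (?\<theta> OO low_place)"
      by (rule partial_hom_OO) unfold_locales
    show "\<exists>y. (?\<theta> OO low_place) x y" if x: "x \<in> E" for x
    proof -
      obtain r c where c: "\<And>j. j < r \<Longrightarrow> c j \<in> adjoin (range cst) {g}"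
        "x ^ r + (\<Sum>j<r. c j * x ^ j) = 0" using int[OF x] by blast
      obtain y where y: "?\<theta> x y" using \<theta>_dom x E(3) by blast
      have "\<forall>j. j < r \<longrightarrow> (\<exists>d. ?\<theta> (c j) d \<and> (\<exists>z. low_place d z))" using coeff c(1) by blast
      then obtain d where d: "\<And>j. j < r \<Longrightarrow> ?\<theta> (c j) (d j) \<and> (\<exists>z. low_place (d j) z)" by metis
      \<comment> \<open>The integral equation is transported to the commutative fraction field,
        where the place is defined and integrality gives \<open>y\<close> an image.\<close>
      have "?\<theta> (x ^ r + (\<Sum>j<r. c j * x ^ j)) (y ^ r + (\<Sum>j<r. d j * y ^ j))"
        using d y by (intro \<theta>.add \<theta>.power \<theta>.sum \<theta>.mult) auto
      then have "y ^ r + (\<Sum>j<r. d j * y ^ j) = 0"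
        unfolding c(2) by (rule \<theta>.functional[OF _ \<theta>.zero])
      with conjunct2[OF d] obtain z where "low_place y z"
        using low.integral_in_dom[of r d y] by blast
      then show ?thesis using y by (intro exI relcomppI)
    qed
    show "(?\<theta> OO low_place) (cst a) (to_fract [:a:])" for a using \<theta>c lowc by blast
    show "(?\<theta> OO low_place) g \<gamma>" using \<theta>g lowg by blast
    show "\<gamma> \<notin> fract_consts" unfolding \<gamma>_def by (rule kb)
  qed (use E g in auto)
qed

text \<open>The relation of least degree has coefficients in \<open>H(g)\<close> that centralize
  \<open>H\<close>; since \<open>H(g)\<close> is generated by \<open>H\<close> and
  \<open>k(g)\<close>, they lie in \<open>k(g)\<close>.\<close>

lemma algebraic_imp_integral:
  assumes g: "g \<in> F" and e: "e \<in> F" "algebraic_over (adjoin H {g}) e"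
  shows "\<exists>r c. (\<forall>j<r. c j \<in> adjoin (range cst) {g}) \<and> e ^ r + (\<Sum>j<r. c j * e ^ j) = 0"
proof -
  let ?K = "adjoin (range cst) {g}"
  have KF: "?K \<subseteq> F" using g cst_in_F by (intro adjoin_least division_subring_F) auto
  have "adjoin H {g} \<subseteq> adjoin H ?K"
    using adjoin_base[of H ?K] adjoin_gen[of ?K H] adjoin_gen[of "{g}" "range cst"]
    by (intro adjoin_least division_subring_adjoin) auto
  moreover obtain r c where c: "\<And>j. j < r \<Longrightarrow> c j \<in> adjoin H {g}"
    "\<And>j y. j < r \<Longrightarrow> y \<in> H \<Longrightarrow> y * c j = c j * y" "e ^ r + (\<Sum>j<r. c j * e ^ j) = 0"
    using centralizing_relation[OF division_subring_adjoin adjoin_base _ e(2)] H_F_commute[OF _ e(1)]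
    by blast
  ultimately have "\<forall>j<r. c j \<in> ?K"
    using adjoin_centralizer_subset[OF division_subring_adjoin adjoin_base KF] by blast
  then show ?thesis using c(3) by blast
qed

text \<open>Read in contrapositive: an element not algebraic over \<open>H\<close> is not a central
  constant.\<close>

lemma cst_algebraic: "algebraic_over H (cst a)"
proof -
  have "cst a \<in> H" by (auto simp: H_eq cst_def)
  then have "adjoin H {cst a} = H"
    using adjoin_least[OF division_subring_H order.refl, of "{cst a}"] adjoin_base[of H "{cst a}"] by blast
  moreover have "finite_left_basis H H {1}"
    using division_subring_1[OF division_subring_H] by (auto simp: finite_left_basis_def)
  ultimately show ?thesis unfolding algebraic_over_def finite_left_dim_def by auto
qed

end

theorem theorem1p1:
  fixes \<iota> :: "('n::finite, 'h::division_ring) mpoly \<Rightarrow> 'd::division_ring"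
    and L :: "'d set"
  assumes "finite_left_dim (ring_center :: 'h set) UNIV"
    and "right_fraction_ring \<iota>"
    and "division_subring L"
    and "const_image \<iota> UNIV \<subseteq> L"
  shows "(CARD('n) = 1 \<and> L \<noteq> const_image \<iota> UNIV \<longrightarrow>
            (\<exists>f \<in> rational_functions \<iota> ring_center - const_image \<iota> ring_center.
               L = adjoin (const_image \<iota> UNIV) {f}))
       \<and> ((\<exists>g \<in> rational_functions \<iota> ring_center.
               algebraic_extension (adjoin (const_image \<iota> UNIV) {g}) L \<and>
               \<not> algebraic_over (const_image \<iota> UNIV) g) \<longrightarrow>
            (\<exists>f \<in> rational_functions \<iota> ring_center - const_image \<iota> ring_center.
               L = adjoin (const_image \<iota> UNIV) {f}))"
proof -
  interpret fraction_ring_extension \<iota> by unfold_locales (fact assms)+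
  let ?E = "L \<inter> F"
  have E: "division_subring ?E"
    by (rule division_subring_Int[OF assms(3) division_subring_F])
  have cE: "range cst \<subseteq> ?E"
    using cst_in_F assms(4) by (auto simp: H_eq cst_def)
  show ?thesis
  proof (intro conjI impI)
    assume 1: "CARD('n) = 1 \<and> L \<noteq> H"
    \<comment> \<open>\<open>L\<close> is generated by \<open>H\<close> and \<open>?E\<close>, so
      constants alone in \<open>?E\<close> would give \<open>L = H\<close>.\<close>
    have "\<exists>g\<in>?E. g \<notin> range cst"
    proof (rule ccontr)
      assume "\<not> ?thesis"
      then have "?E \<subseteq> H" by (auto simp: H_eq cst_def)
      then have "adjoin H ?E \<subseteq> H" by (intro adjoin_least division_subring_H) auto
      then show False using 1 assms(4) intermediate_eq_adjoin[OF assms(3,4)] by blast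
    qed
    then show "\<exists>f \<in> F - const_image \<iota> ring_center. L = adjoin H {f}"
      using center_simple_univariate[OF _ E cE] 1 simple_if_center_simple[OF assms(3,4)] by blast
  next
    assume "\<exists>g\<in>F. algebraic_extension (adjoin H {g}) L \<and> \<not> algebraic_over H g"
    then obtain g where g: "g \<in> F" "adjoin H {g} \<subseteq> L" "\<not> algebraic_over H g"
      and alg: "\<And>x. x \<in> L \<Longrightarrow> algebraic_over (adjoin H {g}) x"
      by (auto simp: algebraic_extension_def)
    have "g \<in> ?E" using g adjoin_gen[of "{g}" H] by blast
    moreover have "g \<notin> range cst" using g(3) cst_algebraic by blast
    ultimately show "\<exists>f \<in> F - const_image \<iota> ring_center. L = adjoin H {f}"
      using center_simple_algebraic[OF E cE] algebraic_imp_integral[OF g(1)] alg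
        simple_if_center_simple[OF assms(3,4)] by blast
  qed
qed

end
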